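(* There exists an algorithm that, given as input a scoring protocol $\alpha$ (for $m$ candidates) encoded in unary and an instance $I$ of the Destructive Shift Bribery problem (with the same number $m$ of candidates), tests in polynomial time whether $I$ is a "yes"-instance for the voting rule defined by the scoring protocol $\alpha$.
   Context: **Elections.** An election is a pair $E=(C,V)$, where $C=\{c_1,\dots,c_m\}$ is a finite set of candidates and $V=\{v_1,\dots,v_n\}$ is a finite multiset of voters; each voter $v$ has a strict ranking (preference order) of all candidates from best to worst, and $\mathrm{pos}_v(c)\in\{1,\dots,m\}$ is the position of $c$ in $v$'s ranking (1 = best). An election rule $\mathcal{R}$ maps each election $E$ to a set $\mathcal{R}(E)\subseteq C$ of (tied) winners; $c$ is the unique winner if $\mathcal{R}(E)=\{c\}$. **Destructive Shift Bribery for $\mathcal{R}$.** Input: an election $E=(C,V)$ with $m$ candidates and $n$ voters, a despised candidate $d\in C$, a budget $B$ (a nonnegative integer), and for each voter $v_i$ a price function $\rho_i$. Shifting $d$ back by $t$ positions in a vote moves $d$ $t$ places towards the end of the ranking, each passed candidate moving up by one place and all else unchanged. A price function for a voter $v$ with $j=\mathrm{pos}_v(d)$ is $\rho:\mathbb{N}\to\mathbb{N}\cup\{+\infty\}$ with $\rho(0)=0$, $\rho(i)\le\rho(i')$ for $i<i'\le m-j$, and $\rho(i)=+\infty$ for $i>m-j$; $\rho(i)$ is the cost of shifting $d$ back by $i$ positions in $v$'s ranking. Price functions are encoded by listing their values at all arguments where they are finite; numbers are in binary unless stated otherwise. Question: are there nonnegative integers $t_1,\dots,t_n$ with $\sum_i\rho_i(t_i)\le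 B$ such that, after shifting $d$ back by $t_i$ positions in the ranking of each $v_i$, $d$ is not the unique $\mathcal{R}$-winner? **Scoring protocols.** A scoring protocol for $m$ candidates is a vector $\alpha=(\alpha_1,\dots,\alpha_m)$ of nonincreasing, nonnegative integers; under the rule it defines, the score of $c$ is $\sum_{v\in V}\alpha_{\mathrm{pos}_v(c)}$, and the candidates with the highest score are the winners. *)

theory Defs
  imports "HOL-Library.Extended_Nat" "HOL-Computational_Algebra.Polynomial"
begin

section \<open>Elections and Destructive Shift Bribery\<close>

text \<open>
  A vote is the list of all candidates from best to worst; the voters \<open>v\<^sub>1, \<dots>, v\<^sub>n\<close> are given as a
  list of votes, so that price functions and shifts can be attached to individual voters.
\<close>

type_synonym 'c vote = "'c list"
type_synonym 'c rule = "'c set \<Rightarrow> 'c vote list \<Rightarrow> 'c set"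

definition election :: "'c set \<Rightarrow> 'c vote list \<Rightarrow> bool" where
  "election C V \<longleftrightarrow> finite C \<and> (\<forall>v\<in>set V. distinct v \<and> set v = C)"

definition pos :: "'c vote \<Rightarrow> 'c \<Rightarrow> nat" where
  "pos v c = length (takeWhile (\<lambda>x. x \<noteq> c) v) + 1"

definition shift_back :: "'c \<Rightarrow> nat \<Rightarrow> 'c vote \<Rightarrow> 'c vote" where
  "shift_back d t v =
     (let r = remove1 d v; k = (pos v d - 1) + t in take k r @ d # drop k r)"

definition price_function :: "nat \<Rightarrow> nat \<Rightarrow> (nat \<Rightarrow> enat) \<Rightarrow> bool" where
  "price_function m j \<rho> \<longleftrightarrow>
     \<rho> 0 = 0 \<and> (\<forall>i i'. i < i' \<and> i' \<le> m - j \<longrightarrow> \<rho> i \<le> \<rho> i') \<and> (\<forall>i. i > m - j \<longrightarrow> \<rho> i = \<infinity>)"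

record 'c bribery =
  cands :: "'c set"
  votes :: "'c vote list"
  despised :: 'c
  budget :: nat
  prices :: "(nat \<Rightarrow> enat) list"

definition bribery_instance :: "'c bribery \<Rightarrow> bool" where
  "bribery_instance I \<longleftrightarrow>
     election (cands I) (votes I) \<and> despised I \<in> cands I \<and>
     length (prices I) = length (votes I) \<and>
     (\<forall>i < length (votes I).
        price_function (card (cands I)) (pos (votes I ! i) (despised I)) (prices I ! i))"

definition destructive_shift_bribery :: "'c rule \<Rightarrow> 'c bribery \<Rightarrow> bool" where
  "destructive_shift_bribery R I \<longleftrightarrow>
     (\<exists>ts :: nat list. length ts = length (votes I) \<and>
        (\<Sum>i < length (votes I). (prices I ! i) (ts ! i)) \<le> enat (budget I) \<and>
        R (cands I) (map2 (shift_back (despised I)) ts (votes I)) \<noteq> {despised I})"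

definition scoring_protocol :: "nat \<Rightarrow> nat list \<Rightarrow> bool" where
  "scoring_protocol m \<alpha> \<longleftrightarrow> length \<alpha> = m \<and> sorted_wrt (\<ge>) \<alpha>"

text \<open>Positions are counted from 1, whereas list indices start at 0.\<close>

definition score :: "nat list \<Rightarrow> 'c vote list \<Rightarrow> 'c \<Rightarrow> nat" where
  "score \<alpha> V c = (\<Sum>v\<leftarrow>V. \<alpha> ! (pos v c - 1))"

definition scoring_rule :: "nat list \<Rightarrow> 'c rule" where
  "scoring_rule \<alpha> C V = {c \<in> C. \<forall>c'\<in>C. score \<alpha> V c' \<le> score \<alpha> V c}"


section \<open>Encoding of inputs\<close>

datatype symbol = Bit bool | Sep

text \<open>Binary representation, least significant bit first, without leading zeros.\<close>

fun bits :: "nat \<Rightarrow> bool list" where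
  "bits n = (if n = 0 then [] else odd n # bits (n div 2))"

declare bits.simps [simp del]

definition binary :: "nat \<Rightarrow> symbol list" where
  "binary n = map Bit (bits n) @ [Sep]"

definition unary :: "nat \<Rightarrow> symbol list" where
  "unary n = replicate n (Bit True) @ [Sep]"

definition enc_list :: "('a \<Rightarrow> symbol list) \<Rightarrow> 'a list \<Rightarrow> symbol list" where
  "enc_list f xs = binary (length xs) @ concat (map f xs)"

definition finite_prices :: "(nat \<Rightarrow> enat) \<Rightarrow> nat list" where
  "finite_prices \<rho> = map (\<lambda>i. the_enat (\<rho> i)) (sorted_list_of_set {i. \<rho> i \<noteq> \<infinity>})"

text \<open>
  For \<open>m\<close> candidates, the candidates are the numbers \<open>1, \<dots>, m\<close>; the set of candidates is thus
  determined by the length of the scoring protocol. Only the protocol is written in unary.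
\<close>

definition encode :: "nat list \<Rightarrow> nat bribery \<Rightarrow> symbol list" where
  "encode \<alpha> I =
     enc_list unary \<alpha> @
     enc_list (enc_list binary) (votes I) @
     binary (despised I) @
     binary (budget I) @
     enc_list (enc_list binary) (map finite_prices (prices I))"


section \<open>Algorithms: random access machines with logarithmic cost\<close>

text \<open>
  The machine is that of Cook and Reckhow (Time bounded random access machines, 1973), with natural
  numbers in the registers (hence truncated subtraction). An algorithm is a finite program; \<open>X\<close> is
  the contents of the registers. In \<open>Load\<close> and \<open>Store\<close> the addressing is indirect, and \<open>Halt b\<close>
  stops with the answer \<open>b\<close>. The input is a one-way read-only string; \<open>Read\<close> delivers 0 once it is
  exhausted. A program counter outside the program is stuck, without an answer.
\<close>

datatype instr =
    Const nat nat
  | Add nat nat nat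
  | Sub nat nat nat
  | Load nat nat
  | Store nat nat
  | Read nat
  | JumpPos nat nat
  | Halt bool

type_synonym program = "instr list"
type_synonym config = "nat \<times> (nat \<Rightarrow> nat) \<times> symbol list"

fun code :: "symbol \<Rightarrow> nat" where
  "code (Bit False) = 1"
| "code (Bit True) = 2"
| "code Sep = 3"

fun step :: "instr \<Rightarrow> config \<Rightarrow> config option" where
  "step (Const r c) (pc, X, w) = Some (pc + 1, X(r := c), w)"
| "step (Add r s t) (pc, X, w) = Some (pc + 1, X(r := X s + X t), w)"
| "step (Sub r s t) (pc, X, w) = Some (pc + 1, X(r := X s - X t), w)"
| "step (Load r s) (pc, X, w) = Some (pc + 1, X(r := X (X s)), w)"
| "step (Store r s) (pc, X, w) = Some (pc + 1, X(X r := X s), w)"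
| "step (Read r) (pc, X, w) =
     Some (pc + 1, X(r := (case w of [] \<Rightarrow> 0 | a # _ \<Rightarrow> code a)), tl w)"
| "step (JumpPos r l) (pc, X, w) = Some (if X r > 0 then l else pc + 1, X, w)"
| "step (Halt b) (pc, X, w) = None"

definition bitlen :: "nat \<Rightarrow> nat" where
  "bitlen n = max 1 (length (bits n))"

text \<open>
  Direct register addresses and constants are part of the fixed program and cost nothing extra;
  register contents, in particular computed addresses, are charged by their binary length.
\<close>

fun cost :: "instr \<Rightarrow> (nat \<Rightarrow> nat) \<Rightarrow> nat" where
  "cost (Const r c) X = 1"
| "cost (Add r s t) X = bitlen (X s) + bitlen (X t)"
| "cost (Sub r s t) X = bitlen (X s) + bitlen (X t)"
| "cost (Load r s) X = bitlen (X s) + bitlen (X (X s))"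
| "cost (Store r s) X = bitlen (X r) + bitlen (X s)"
| "cost (Read r) X = 1"
| "cost (JumpPos r l) X = bitlen (X r)"
| "cost (Halt b) X = 1"

inductive runs :: "program \<Rightarrow> config \<Rightarrow> nat \<Rightarrow> bool \<Rightarrow> bool" for P :: program where
  halt: "pc < length P \<Longrightarrow> P ! pc = Halt b \<Longrightarrow> runs P (pc, X, w) (cost (P ! pc) X) b"
| step: "pc < length P \<Longrightarrow> step (P ! pc) (pc, X, w) = Some s \<Longrightarrow> runs P s T b \<Longrightarrow>
     runs P (pc, X, w) (cost (P ! pc) X + T) b"

definition answers_within :: "program \<Rightarrow> symbol list \<Rightarrow> nat \<Rightarrow> bool \<Rightarrow> bool" where
  "answers_within P w t b \<longleftrightarrow> (\<exists>T \<le> t. runs P (0, \<lambda>_. 0, w) T b)"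


section \<open>Sanity checks: runs are deterministic and inputs are uniquely decodable\<close>

lemma runs_deterministic: "runs P s T b \<Longrightarrow> runs P s T' b' \<Longrightarrow> T = T' \<and> b = b'"
proof (induction arbitrary: T' b' rule: runs.induct)
  case (halt pc b X w)
  from halt(3) show ?case by cases (use halt in auto)
next
  case (step pc X w s T b)
  from step.prems show ?case
  proof cases
    case halt
    then show ?thesis using step.hyps by auto
  next
    case (step s' T1)
    then show ?thesis using step.hyps step.IH by auto
  qed
qed

lemma bits_inject: "bits m = bits n \<Longrightarrow> m = n"
proof (induction m arbitrary: n rule: less_induct)
  case (less m)
  show ?case
  proof (cases "m = 0 \<or> n = 0")
    case True
    then show ?thesis using less.prems by (auto simp: bits.simps[of m] bits.simps[of n] split: if_splits)
  next
    case False
    then have "odd m = odd n" "bits (m div 2) = bits (n div 2)"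
      using less.prems by (auto simp: bits.simps[of m] bits.simps[of n])
    with less.IH[of "m div 2" "n div 2"] False have "m div 2 = n div 2" "m mod 2 = n mod 2"
      by (auto simp: parity_cases odd_iff_mod_2_eq_one even_iff_mod_2_eq_zero)
    then show ?thesis by (metis div_mult_mod_eq)
  qed
qed

definition self_delimiting :: "('a \<Rightarrow> symbol list) \<Rightarrow> bool" where
  "self_delimiting f \<longleftrightarrow> (\<forall>x y u v. f x @ u = f y @ v \<longrightarrow> x = y \<and> u = v)"

lemma map_Bit_Sep: "map Bit xs @ Sep # u = map Bit ys @ Sep # v \<Longrightarrow> xs = ys \<and> u = v"
proof (induction xs arbitrary: ys)
  case Nil then show ?case by (cases ys) auto
next
  case (Cons x xs) then show ?case by (cases ys) auto
qed

lemma self_delimiting_binary: "self_delimiting binary"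
  by (auto simp: self_delimiting_def binary_def dest!: map_Bit_Sep bits_inject)

lemma self_delimiting_unary: "self_delimiting unary"
proof -
  have "unary n = map Bit (replicate n True) @ [Sep]" for n by (simp add: unary_def)
  then show ?thesis
    by (auto simp: self_delimiting_def simp del: map_replicate dest!: map_Bit_Sep)
qed

lemma self_delimiting_enc_list:
  assumes "self_delimiting f"
  shows "self_delimiting (enc_list f)"
proof -
  have *: "xs = ys \<and> u = v"
    if "length xs = length ys" "concat (map f xs) @ u = concat (map f ys) @ v" for xs ys u v
    using that
  proof (induction rule: list_induct2)
    case (Cons x xs y ys)
    have "f x @ (concat (map f xs) @ u) = f y @ (concat (map f ys) @ v)"
      using Cons.prems by simp
    then have "x = y" "concat (map f xs) @ u = concat (map f ys) @ v"
      using assms unfolding self_delimiting_def by blast+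
    with Cons.IH show ?case by simp
  qed simp
  have "xs = ys \<and> u = v" if "enc_list f xs @ u = enc_list f ys @ v" for xs ys u v
  proof -
    have "binary (length xs) @ concat (map f xs) @ u = binary (length ys) @ concat (map f ys) @ v"
      using that by (simp add: enc_list_def)
    then have "length xs = length ys" "concat (map f xs) @ u = concat (map f ys) @ v"
      using self_delimiting_binary unfolding self_delimiting_def by blast+
    then show ?thesis using * by blast
  qed
  then show ?thesis by (auto simp: self_delimiting_def)
qed

lemma finite_prices_inject:
  assumes "price_function m j \<rho>" "price_function m j \<rho>'" "finite_prices \<rho> = finite_prices \<rho>'"
  shows "\<rho> = \<rho>'"
proof -
  have init: "sorted_list_of_set {i. \<sigma> i \<noteq> \<infinity>} = [0..<length (finite_prices \<sigma>)]"
    "{i. \<sigma> i \<noteq> \<infinity>} = {..<length (finite_prices \<sigma>)}"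
    if pf: "price_function m j \<sigma>" for \<sigma>
  proof -
    let ?S = "{i. \<sigma> i \<noteq> \<infinity>}"
    have sub: "?S \<subseteq> {..m - j}" using pf by (force simp: price_function_def not_le[symmetric])
    then have fin: "finite ?S" by (rule finite_subset) simp
    have down: "i \<in> ?S" if "i < k" "k \<in> ?S" for i k
    proof -
      have "\<sigma> i \<le> \<sigma> k" using pf that sub by (auto simp: price_function_def)
      then show ?thesis using that by (cases "\<sigma> i") auto
    qed
    have ne: "0 \<in> ?S" using pf by (simp add: price_function_def zero_enat_def)
    have eq: "?S = {..Max ?S}"
    proof (intro equalityI subsetI)
      fix i assume "i \<in> ?S" then show "i \<in> {..Max ?S}" using fin by simp
    next
      fix i assume "i \<in> {..Max ?S}"
      moreover have "Max ?S \<in> ?S" using fin ne by (intro Max_in) auto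
      ultimately show "i \<in> ?S" using down[of i "Max ?S"] by (cases "i = Max ?S") auto
    qed
    define N where "N = Suc (Max ?S)"
    have S: "?S = {..<N}" using eq by (simp add: N_def lessThan_Suc_atMost)
    have "sorted_list_of_set ?S = [0..<N]"
      unfolding S by (simp add: atLeast0LessThan[symmetric])
    moreover from this have "length (finite_prices \<sigma>) = N" by (simp add: finite_prices_def)
    ultimately show "sorted_list_of_set ?S = [0..<length (finite_prices \<sigma>)]"
      "?S = {..<length (finite_prices \<sigma>)}" using S by simp_all
  qed
  show ?thesis
  proof
    fix i
    let ?N = "length (finite_prices \<rho>)"
    have dom: "\<rho> i \<noteq> \<infinity> \<longleftrightarrow> i < ?N" "\<rho>' i \<noteq> \<infinity> \<longleftrightarrow> i < ?N"
      using init(2)[OF assms(1)] init(2)[OF assms(2)] assms(3) by auto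
    show "\<rho> i = \<rho>' i"
    proof (cases "i < ?N")
      case True
      have "finite_prices \<rho> ! i = the_enat (\<rho> i)" "finite_prices \<rho>' ! i = the_enat (\<rho>' i)"
        using True assms(3) init(1)[OF assms(1)] init(1)[OF assms(2)]
        by (metis (no_types, lifting) add_0 diff_zero finite_prices_def length_upt nth_map nth_upt)+
      then show ?thesis using assms(3) dom True by auto
    qed (use dom in simp)
  qed
qed

lemma encode_inject:
  assumes "bribery_instance I" "cands I = {1..length \<alpha>}"
    and "bribery_instance I'" "cands I' = {1..length \<alpha>'}"
    and "encode \<alpha> I = encode \<alpha>' I'"
  shows "\<alpha> = \<alpha>' \<and> I = I'"
proof -
  note sd = self_delimiting_binary self_delimiting_enc_list[OF self_delimiting_unary]
    self_delimiting_enc_list[OF self_delimiting_enc_list[OF self_delimiting_binary]]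
  have eq: "\<alpha> = \<alpha>'" "votes I = votes I'" "despised I = despised I'" "budget I = budget I'"
    "map finite_prices (prices I) = map finite_prices (prices I')"
    using assms(5) sd unfolding encode_def self_delimiting_def
    by (metis append.right_neutral)+
  have "prices I = prices I'"
  proof (rule nth_equalityI)
    show len: "length (prices I) = length (prices I')" using eq(5) map_eq_imp_length_eq by blast
    fix i assume i: "i < length (prices I)"
    then have "finite_prices (prices I ! i) = finite_prices (prices I' ! i)"
      using eq(5) len by (metis nth_map)
    with i show "prices I ! i = prices I' ! i"
      using assms eq len by (intro finite_prices_inject) (auto simp: bribery_instance_def)
  qed
  with eq assms show ?thesis by (cases I, cases I') simp
qed

end

theory Submission
  imports Defs "HOL-Library.Countable"
begin

text \<open>
  For a fixed rival \<open>c\<close> of the despised candidate \<open>d\<close>, a shift of \<open>d\<close> by \<open>t\<close> positions in one vote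
  changes the difference of the scores of \<open>c\<close> and \<open>d\<close> by an amount that depends on this vote only.
  Whether \<open>c\<close> can catch up with \<open>d\<close> within the budget is therefore a multiple-choice knapsack
  problem. Its weights are bounded by the unary entries of the protocol, so the dynamic program that
  stores the least cost of each total weight has polynomial size. This program is written in a small
  loop language whose loop limits are not changed inside the loops; it is compiled to the random
  access machine. A step at most doubles the largest register, so polynomially many steps also have
  polynomial logarithmic cost.
\<close>

section \<open>Machine runs\<close>

text \<open>Prices and budget are binary and may be exponential in the input length, so the table
  has to be indexed by score totals and may hold costs only as entries. The rule fails to elect
  \<open>d\<close> alone as soon as one single rival reaches the score of \<open>d\<close>; hence
  each rival can be tested with all other candidates forgotten. The weight of a shift is the score
  of the rival minus that of \<open>d\<close> in the shifted vote, which may be negative. Raised by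
  the top entry \<alpha>_1 of the protocol it lies between 0 and 2 \<alpha>_1, the target for n
  voters becomes n \<alpha>_1, and the totals fill a table of width 2 n \<alpha>_1 + 1. This width
  is quadratic in the input length because \<alpha>_1 is written in unary. Apart from reading, the
  loops are limited by the numbers of candidates and voters and this width only, never by a price.
  The length of the input is not known in advance, so the reading loop is built directly from
  machine instructions around a body without loops.\<close>

inductive steps :: "program \<Rightarrow> nat \<Rightarrow> config \<Rightarrow> config \<Rightarrow> bool" for P where
  stay: "steps P 0 c c"
| move: "pc < length P \<Longrightarrow> step (P ! pc) (pc, X, w) = Some c \<Longrightarrow> steps P k c c' \<Longrightarrow>
    steps P (Suc k) (pc, X, w) c'"

lemma steps_trans: "steps P j a b \<Longrightarrow> steps P k b c \<Longrightarrow> steps P (j + k) a c"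
  by (induction rule: steps.induct) (auto intro: steps.intros)

lemma steps_0 [simp]: "steps P 0 c c' \<longleftrightarrow> c = c'"
  by (auto elim: steps.cases intro: steps.intros)

lemma steps_Suc [simp]:
  "steps P (Suc k) (pc, X, w) c' \<longleftrightarrow>
     pc < length P \<and> (\<exists>c. step (P ! pc) (pc, X, w) = Some c \<and> steps P k c c')"
  by (auto elim: steps.cases intro: steps.intros)

lemma steps_numeral [simp]:
  "steps P (numeral k) (pc, X, w) c' \<longleftrightarrow>
     pc < length P \<and> (\<exists>c. step (P ! pc) (pc, X, w) = Some c \<and> steps P (pred_numeral k) c c')"
  unfolding numeral_eq_Suc by (rule steps_Suc)

fun literal :: "instr \<Rightarrow> nat" where
  "literal (Const r c) = c"
| "literal _ = 0"

lemma length_bits_le: "n < 2 ^ k \<Longrightarrow> length (bits n) \<le> k"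
proof (induction n arbitrary: k rule: less_induct)
  case (less n)
  show ?case
  proof (cases "n = 0")
    case False
    with less.prems obtain j where j: "k = Suc j" by (cases k) auto
    have "length (bits (n div 2)) \<le> j"
      using False less.prems by (intro less.IH) (auto simp: j)
    then show ?thesis using False j by (simp add: bits.simps[of n])
  qed (simp add: bits.simps)
qed

lemma bitlen_le: "n < 2 ^ k \<Longrightarrow> 1 \<le> k \<Longrightarrow> bitlen n \<le> k"
  by (simp add: bitlen_def length_bits_le)

lemma code_less_4: "code a < 4"
  by (cases a rule: code.cases) auto

lemma step_register_bound:
  assumes "step i (pc, X, w) = Some (pc', X', w')" "\<And>r. X r < 2 ^ B" "literal i < 2 ^ B" "2 \<le> B"
  shows "X' r < 2 ^ Suc B"
proof -
  \<comment> \<open>\<open>2 \<le> B\<close> makes room for the codes of input symbols, which are at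
    most 3.\<close>
  have "(4::nat) \<le> 2 ^ B" using power_increasing[of 2 B "2::nat"] assms(4) by simp
  then have c: "code a < 2 * 2 ^ B" for a using code_less_4[of a] by simp
  have X: "X r < 2 * 2 ^ B" for r using assms(2)[of r] by simp
  have "X s + X t < 2 * 2 ^ B" "X s - X t < 2 * 2 ^ B" for s t
    using assms(2)[of s] assms(2)[of t] by simp_all
  with assms c X show ?thesis by (cases i) (auto split: list.splits)
qed

lemma cost_bound:
  assumes "\<And>r. X r < 2 ^ B" "2 \<le> B"
  shows "cost i X \<le> 2 * B"
proof -
  have "bitlen (X r) \<le> B" for r using assms by (intro bitlen_le) auto
  then show ?thesis using assms(2) by (cases i) (auto simp: mult_2 intro!: add_mono intro: le_add2 order_trans)
qed

text \<open>The exponent \<open>B\<close> grows by one with each step while one step fewer remains,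
  so \<open>B + k\<close> stays the same along the run and bounds the cost of every instruction by
  \<open>2 * (B + k)\<close>. The \<open>Suc\<close> pays for the final \<open>Halt\<close>.\<close>

lemma steps_runs:
  assumes "steps P k (pc, X, w) (pc', X', w')" "pc' < length P" "P ! pc' = Halt b"
    and "\<And>r. X r < 2 ^ B" "\<And>i. i \<in> set P \<Longrightarrow> literal i < 2 ^ B" "2 \<le> B"
  shows "\<exists>T \<le> Suc k * (2 * (B + k)). runs P (pc, X, w) T b"
  using assms
proof (induction k arbitrary: pc X w B)
  case 0
  then have "runs P (pc, X, w) (cost (P ! pc) X) b" "cost (P ! pc) X \<le> Suc 0 * (2 * (B + 0))"
    using runs.halt[of pc' P b X' w'] cost_bound[of X' B "P ! pc'"] by auto
  then show ?case by blast
next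
  case (Suc k)
  from Suc.prems(1) obtain pc1 X1 w1 where s: "pc < length P"
      "step (P ! pc) (pc, X, w) = Some (pc1, X1, w1)" "steps P k (pc1, X1, w1) (pc', X', w')"
    by (cases rule: steps.cases) auto
  have "\<exists>T \<le> Suc k * (2 * (Suc B + k)). runs P (pc1, X1, w1) T b"
  proof (rule Suc.IH[OF s(3) Suc.prems(2,3)])
    show "X1 r < 2 ^ Suc B" for r
      using step_register_bound[OF s(2)] Suc.prems s(1) by auto
    show "literal i < 2 ^ Suc B" if "i \<in> set P" for i
      using Suc.prems(5)[OF that] by simp
  qed (use Suc.prems in auto)
  then obtain T where T: "T \<le> Suc k * (2 * (Suc B + k))" "runs P (pc1, X1, w1) T b" by blast
  have "cost (P ! pc) X \<le> 2 * (B + Suc k)"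
    using cost_bound[of X B "P ! pc"] Suc.prems by auto
  with T(1) have "cost (P ! pc) X + T \<le> Suc (Suc k) * (2 * (B + Suc k))" by simp
  with runs.step[OF s(1,2) T(2)] show ?case by blast
qed


section \<open>A loop language\<close>

datatype var = Symbol | Value | Power | Count | Tok | Cands | Voters | Target | Width | Budget |
  Despised | Start | Ans | Number | Cand | Vote | Price | Voter | Place | Total | Shift | PosD | PosC | Acc

instance var :: countable by countable_datatype

datatype arr = Values | Counts | Best | Next | Gain

datatype loc = Var var | Elem arr nat

type_synonym state = "loc \<Rightarrow> nat"

datatype expr =
    Num nat
  | Get var
  | At arr expr
  | Plus expr expr (infixl "[+]" 65)
  | Minus expr expr (infixl "[-]" 65)

datatype com =
    Skip
  | Assign var expr ("_ ::= _" [61, 61] 61)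
  | Put arr expr expr
  | Seq com com (infixr ";;" 60)
  | IfPos expr com com
  | For var var com

primrec eval :: "expr \<Rightarrow> state \<Rightarrow> nat" where
  "eval (Num n) s = n"
| "eval (Get x) s = s (Var x)"
| "eval (At a e) s = s (Elem a (eval e s))"
| "eval (e [+] f) s = eval e s + eval f s"
| "eval (e [-] f) s = eval e s - eval f s"

primrec iter :: "(nat \<Rightarrow> 'a \<Rightarrow> 'a) \<Rightarrow> nat \<Rightarrow> 'a \<Rightarrow> 'a" where
  "iter f 0 s = s"
| "iter f (Suc n) s = f n (iter f n s)"

text \<open>A loop reads its limit once, on entry, and sets its variable anew in each round, so the
  number of rounds is fixed whatever the body assigns.\<close>

primrec run :: "com \<Rightarrow> state \<Rightarrow> state" where
  "run Skip s = s"
| "run (x ::= e) s = s(Var x := eval e s)"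
| "run (Put a e f) s = s(Elem a (eval e s) := eval f s)"
| "run (c ;; c') s = run c' (run c s)"
| "run (IfPos e c c') s = (if eval e s > 0 then run c s else run c' s)"
| "run (For x y c) s = iter (\<lambda>i s. run c (s(Var x := i))) (s (Var y)) s"

text \<open>Expressions become straight-line code, so the same number is both the running time and
  the length of that code.\<close>

primrec etime :: "expr \<Rightarrow> nat" where
  "etime (Num n) = 1"
| "etime (Get x) = 2"
| "etime (At a e) = etime e + 6"
| "etime (e [+] f) = etime e + etime f + 1"
| "etime (e [-] f) = etime e + etime f + 1"

text \<open>Exact step counts of the compiled code. The 2 in a conditional is the jump over the
  other branch. A loop takes 3 steps to set up its counters and 3 to leave; a round adds 1 for the
  test, 2 for setting the variable and 4 for updating the counters and jumping back.\<close>

primrec time :: "com \<Rightarrow> state \<Rightarrow> nat" where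
  "time Skip s = 0"
| "time (x ::= e) s = etime e + 2"
| "time (Put a e f) s = etime e + etime f + 6"
| "time (c ;; c') s = time c s + time c' (run c s)"
| "time (IfPos e c c') s = etime e + 1 + (if eval e s > 0 then time c s else time c' s + 2)"
| "time (For x y c) s =
     6 + (\<Sum>i<s (Var y). 7 + time c ((iter (\<lambda>i s. run c (s(Var x := i))) i s)(Var x := i)))"


section \<open>Compilation\<close>

text \<open>Registers are divided into eight interleaved banks: scratch space, variables, and one bank for
  each array.\<close>

primrec bank :: "arr \<Rightarrow> nat" where
  "bank Values = 2"
| "bank Counts = 3"
| "bank Best = 4"
| "bank Next = 5"
| "bank Gain = 6"

definition scratch :: "nat \<Rightarrow> nat" where
  "scratch k = 8 * k"

lemma scratch_inject [simp]: "scratch j = scratch k \<longleftrightarrow> j = k"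
  by (simp add: scratch_def)

primrec addr :: "loc \<Rightarrow> nat" where
  "addr (Var x) = 8 * to_nat x + 1"
| "addr (Elem a i) = 8 * i + bank a"

lemma bank_bounds: "2 \<le> bank a" "bank a < 8"
  by (cases a; simp)+

lemma bank_inject [simp]: "bank a = bank b \<longleftrightarrow> a = b"
  by (cases a; cases b; simp)

lemma addr_mod: "addr l mod 8 = (case l of Var x \<Rightarrow> 1 | Elem a i \<Rightarrow> bank a)"
  using bank_bounds by (cases l) auto

lemma addr_div: "addr l div 8 = (case l of Var x \<Rightarrow> to_nat x | Elem a i \<Rightarrow> i)"
  using bank_bounds by (cases l) auto

declare addr.simps [simp del]

lemma addr_inject [simp]: "addr l = addr l' \<longleftrightarrow> l = l'"
proof
  assume "addr l = addr l'"
  then have "addr l mod 8 = addr l' mod 8" "addr l div 8 = addr l' div 8" by simp_all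
  moreover have "bank a \<noteq> 1" for a using bank_bounds(1)[of a] by auto
  ultimately show "l = l'"
    by (auto simp: addr_mod addr_div split: loc.splits)
qed simp

lemma addr_neq_scratch [simp]: "addr l \<noteq> scratch k" "scratch k \<noteq> addr l"
proof -
  have "addr l mod 8 \<noteq> 0"
    using bank_bounds(1) by (cases l) (auto simp: addr_mod intro: less_le_trans[of 0 2])
  moreover have "scratch k mod 8 = 0" by (simp add: scratch_def)
  ultimately show "addr l \<noteq> scratch k" "scratch k \<noteq> addr l" by metis+
qed

text \<open>There is no multiplication instruction. Eight is a power of two, so three doublings turn
  an index into \<open>8 * i\<close>, to which the bank is added.\<close>

abbreviation locate :: "arr \<Rightarrow> nat \<Rightarrow> instr list" where
  "locate a k \<equiv>
     [Add (scratch k) (scratch k) (scratch k), Add (scratch k) (scratch k) (scratch k),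
      Add (scratch k) (scratch k) (scratch k), Const (scratch (Suc k)) (bank a),
      Add (scratch k) (scratch k) (scratch (Suc k))]"

abbreviation jump :: "nat \<Rightarrow> nat \<Rightarrow> instr list" where
  "jump k l \<equiv> [Const (scratch k) 1, JumpPos (scratch k) l]"

text \<open>The scratch registers form a stack and \<open>k\<close> is its height: the value ends up
  in \<open>scratch k\<close>, and everything below is left alone. Registers are copied by adding
  them to 0.\<close>

primrec ecomp :: "expr \<Rightarrow> nat \<Rightarrow> program" where
  "ecomp (Num n) k = [Const (scratch k) n]"
| "ecomp (Get x) k = [Const (scratch k) 0, Add (scratch k) (scratch k) (addr (Var x))]"
| "ecomp (At a e) k = ecomp e k @ locate a k @ [Load (scratch k) (scratch k)]"
| "ecomp (e [+] f) k =
     ecomp e k @ ecomp f (Suc k) @ [Add (scratch k) (scratch k) (scratch (Suc k))]"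
| "ecomp (e [-] f) k =
     ecomp e k @ ecomp f (Suc k) @ [Sub (scratch k) (scratch k) (scratch (Suc k))]"

text \<open>Jump targets are absolute, so the size of a command must be known before its code is
  laid out; it depends neither on the stack height nor on the position.\<close>

primrec csize :: "com \<Rightarrow> nat" where
  "csize Skip = 0"
| "csize (x ::= e) = etime e + 2"
| "csize (Put a e f) = etime e + etime f + 6"
| "csize (c ;; c') = csize c + csize c'"
| "csize (IfPos e c c') = etime e + csize c' + csize c + 3"
| "csize (For x y c) = csize c + 12"

text \<open>In the loop, scratch register \<open>k\<close> holds the number of remaining iterations, and its
  successor the current index.\<close>

primrec ccomp :: "com \<Rightarrow> nat \<Rightarrow> nat \<Rightarrow> program" where
  "ccomp Skip k pc = []"
| "ccomp (x ::= e) k pc =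
     ecomp e k @ [Const (scratch (Suc k)) 0, Add (addr (Var x)) (scratch k) (scratch (Suc k))]"
| "ccomp (Put a e f) k pc =
     ecomp e k @ locate a k @ ecomp f (Suc k) @ [Store (scratch k) (scratch (Suc k))]"
| "ccomp (c ;; c') k pc = ccomp c k pc @ ccomp c' k (pc + csize c)"
| "ccomp (IfPos e c c') k pc =
     ecomp e k @ [JumpPos (scratch k) (pc + etime e + csize c' + 3)] @
     ccomp c' k (pc + etime e + 1) @ jump k (pc + etime e + csize c' + csize c + 3) @
     ccomp c k (pc + etime e + csize c' + 3)"
| "ccomp (For x y c) k pc =
     [Const (scratch k) 0, Add (scratch k) (scratch k) (addr (Var y)),
      Const (scratch (Suc k)) 0, JumpPos (scratch k) (pc + 6)] @
     jump (k + 2) (pc + csize c + 12) @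
     [Const (scratch (k + 2)) 0, Add (addr (Var x)) (scratch (Suc k)) (scratch (k + 2))] @
     ccomp c (k + 2) (pc + 8) @
     [Const (scratch (k + 2)) 1, Sub (scratch k) (scratch k) (scratch (k + 2)),
      Add (scratch (Suc k)) (scratch (Suc k)) (scratch (k + 2)),
      JumpPos (scratch (k + 2)) (pc + 3)]"

lemma length_ecomp [simp]: "length (ecomp e k) = etime e"
  by (induction e arbitrary: k) auto

lemma length_ccomp [simp]: "length (ccomp c k pc) = csize c"
  by (induction c arbitrary: k pc) auto

section \<open>Correctness of the compiled code\<close>

primrec code_at :: "program \<Rightarrow> nat \<Rightarrow> instr list \<Rightarrow> bool" where
  "code_at P pc [] \<longleftrightarrow> True"
| "code_at P pc (i # is) \<longleftrightarrow> pc < length P \<and> P ! pc = i \<and> code_at P (Suc pc) is"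

lemma code_at_append [simp]:
  "code_at P pc (is @ js) \<longleftrightarrow> code_at P pc is \<and> code_at P (pc + length is) js"
  by (induction "is" arbitrary: pc) auto

lemma code_at_self: "code_at (ps @ is @ qs) (length ps) is"
proof (induction "is" arbitrary: ps)
  case (Cons i "is")
  from Cons.IH[of "ps @ [i]"] show ?case by (simp add: nth_append)
qed simp

definition represents :: "(nat \<Rightarrow> nat) \<Rightarrow> state \<Rightarrow> bool" where
  "represents X s \<longleftrightarrow> (\<forall>l. X (addr l) = s l)"

text \<open>The frame condition of the stack: pending operands, pending addresses and the counters
  of enclosing loops lie below \<open>k\<close>.\<close>

definition same_below :: "nat \<Rightarrow> (nat \<Rightarrow> nat) \<Rightarrow> (nat \<Rightarrow> nat) \<Rightarrow> bool" where
  "same_below k X Y \<longleftrightarrow> (\<forall>j<k. X (scratch j) = Y (scratch j))"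

lemma represents_scratch [simp]: "represents (X(scratch k := v)) s \<longleftrightarrow> represents X s"
  by (simp add: represents_def)

lemma represents_addr: "represents X s \<Longrightarrow> X (addr l) = s l"
  by (simp add: represents_def)

lemma represents_update [intro]: "represents X s \<Longrightarrow> represents (X(addr l := v)) (s(l := v))"
  by (simp add: represents_def)

lemma same_below_refl [simp]: "same_below k X X"
  by (simp add: same_below_def)

lemma same_below_trans [trans]: "same_below k X Y \<Longrightarrow> same_below k Y Z \<Longrightarrow> same_below k X Z"
  by (simp add: same_below_def)

lemma same_below_mono: "same_below k X Y \<Longrightarrow> j \<le> k \<Longrightarrow> same_below j X Y"
  by (simp add: same_below_def)

lemma same_below_update [simp]:
  "j \<le> k \<Longrightarrow> same_below j X (Y(scratch k := v)) \<longleftrightarrow> same_below j X Y"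
  "same_below j X (Y(addr l := v)) \<longleftrightarrow> same_below j X Y"
  by (auto simp: same_below_def)

lemma same_below_D: "same_below k X Y \<Longrightarrow> j < k \<Longrightarrow> Y (scratch j) = X (scratch j)"
  by (simp add: same_below_def)

lemma locate_correct:
  assumes "code_at P pc (locate a k)"
  shows "steps P 5 (pc, X, w)
    (pc + 5, X(scratch k := addr (Elem a (X (scratch k))), scratch (Suc k) := bank a), w)"
proof -
  have sum: "n + n + (n + n) + (n + n + (n + n)) + bank a = addr (Elem a n)" for n
    by (simp add: addr.simps)
  show ?thesis using assms by (auto simp: sum fun_upd_twist)
qed

text \<open>The second operand is evaluated one level higher, so \<open>same_below (Suc k)\<close>
  preserves the first one in \<open>scratch k\<close> until both are combined.\<close>

lemma ecomp_correct:
  assumes "code_at P pc (ecomp e k)" "represents X s"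
  shows "\<exists>X'. steps P (etime e) (pc, X, w) (pc + etime e, X', w) \<and> represents X' s \<and>
    same_below k X X' \<and> X' (scratch k) = eval e s"
  using assms
proof (induction e arbitrary: pc k X)
  case (Get x)
  let ?X = "X(scratch k := s (Var x))"
  have "steps P 2 (pc, X, w) (pc + 2, ?X, w)"
    using Get.prems by (auto simp: represents_addr)
  moreover have "represents ?X s" "same_below k X ?X" "?X (scratch k) = eval (Get x) s"
    using Get.prems(2) by simp_all
  ultimately show ?case unfolding etime.simps by blast
next
  case (At a e)
  from At.prems obtain X1 where X1: "steps P (etime e) (pc, X, w) (pc + etime e, X1, w)"
      "represents X1 s" "same_below k X X1" "X1 (scratch k) = eval e s"
    using At.IH[of pc k X] by auto
  define X2 where "X2 = X1(scratch k := addr (Elem a (eval e s)), scratch (Suc k) := bank a)"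
  have "represents X2 s" using X1(2) by (simp add: X2_def)
  then have "X2 (addr (Elem a (eval e s))) = s (Elem a (eval e s))" by (rule represents_addr)
  moreover have "X2 (scratch k) = addr (Elem a (eval e s))" by (simp add: X2_def)
  ultimately have "steps P 1 (pc + etime e + 5, X2, w)
      (pc + etime e + 5 + 1, X2(scratch k := s (Elem a (eval e s))), w)"
    using At.prems(1) by (auto simp: ac_simps numeral_eq_Suc)
  moreover have "steps P 5 (pc + etime e, X1, w) (pc + etime e + 5, X2, w)"
    unfolding X2_def X1(4)[symmetric] using At.prems(1) by (intro locate_correct) simp
  ultimately have "steps P (etime e + 5 + 1) (pc, X, w)
      (pc + etime e + 5 + 1, X2(scratch k := s (Elem a (eval e s))), w)"
    using steps_trans X1(1) by blast
  then have "steps P (etime (At a e)) (pc, X, w)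
      (pc + etime (At a e), X2(scratch k := s (Elem a (eval e s))), w)"
    by (simp add: ac_simps)
  moreover have "represents (X2(scratch k := s (Elem a (eval e s)))) s"
      "same_below k X (X2(scratch k := s (Elem a (eval e s))))"
      "(X2(scratch k := s (Elem a (eval e s)))) (scratch k) = eval (At a e) s"
    using \<open>represents X2 s\<close> X1(3) by (simp_all add: X2_def)
  ultimately show ?case by blast
next
  case (Plus e f)
  from Plus.prems obtain X1 where X1: "steps P (etime e) (pc, X, w) (pc + etime e, X1, w)"
      "represents X1 s" "same_below k X X1" "X1 (scratch k) = eval e s"
    using Plus.IH(1)[of pc k X] by auto
  from Plus.prems X1(2) obtain X2 where X2:
      "steps P (etime f) (pc + etime e, X1, w) (pc + etime e + etime f, X2, w)"
      "represents X2 s" "same_below (Suc k) X1 X2" "X2 (scratch (Suc k)) = eval f s"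
    using Plus.IH(2)[of "pc + etime e" "Suc k" X1] by auto
  have "steps P (etime e + etime f + 1) (pc, X, w)
      (pc + etime e + etime f + 1, X2(scratch k := eval e s + eval f s), w)"
    by (rule steps_trans[OF steps_trans[OF X1(1) X2(1)]])
      (use Plus.prems X1(4) X2(4) same_below_D[OF X2(3), of k] in auto)
  then have "steps P (etime (e [+] f)) (pc, X, w)
      (pc + etime (e [+] f), X2(scratch k := eval e s + eval f s), w)"
    by (simp add: ac_simps)
  moreover have "represents (X2(scratch k := eval e s + eval f s)) s"
      "same_below k X (X2(scratch k := eval e s + eval f s))"
      "(X2(scratch k := eval e s + eval f s)) (scratch k) = eval (e [+] f) s"
    using X1(3) X2(2) same_below_mono[OF X2(3), of k] by (auto intro: same_below_trans)
  ultimately show ?case by blast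
next
  case (Minus e f)
  from Minus.prems obtain X1 where X1: "steps P (etime e) (pc, X, w) (pc + etime e, X1, w)"
      "represents X1 s" "same_below k X X1" "X1 (scratch k) = eval e s"
    using Minus.IH(1)[of pc k X] by auto
  from Minus.prems X1(2) obtain X2 where X2:
      "steps P (etime f) (pc + etime e, X1, w) (pc + etime e + etime f, X2, w)"
      "represents X2 s" "same_below (Suc k) X1 X2" "X2 (scratch (Suc k)) = eval f s"
    using Minus.IH(2)[of "pc + etime e" "Suc k" X1] by auto
  have "steps P (etime e + etime f + 1) (pc, X, w)
      (pc + etime e + etime f + 1, X2(scratch k := eval e s - eval f s), w)"
    by (rule steps_trans[OF steps_trans[OF X1(1) X2(1)]])
      (use Minus.prems X1(4) X2(4) same_below_D[OF X2(3), of k] in auto)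
  then have "steps P (etime (e [-] f)) (pc, X, w)
      (pc + etime (e [-] f), X2(scratch k := eval e s - eval f s), w)"
    by (simp add: ac_simps)
  moreover have "represents (X2(scratch k := eval e s - eval f s)) s"
      "same_below k X (X2(scratch k := eval e s - eval f s))"
      "(X2(scratch k := eval e s - eval f s)) (scratch k) = eval (e [-] f) s"
    using X1(3) X2(2) same_below_mono[OF X2(3), of k] by (auto intro: same_below_trans)
  ultimately show ?case by blast
qed auto

lemma ccomp_correct:
  assumes "code_at P pc (ccomp c k pc)" "represents X s"
  shows "\<exists>X'. steps P (time c s) (pc, X, w) (pc + csize c, X', w) \<and>
    represents X' (run c s) \<and> same_below k X X'"
  using assms
proof (induction c arbitrary: pc k X s)
  case Skip
  then show ?case by auto
next
  case (Assign x e)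
  from Assign.prems obtain X1 where X1: "steps P (etime e) (pc, X, w) (pc + etime e, X1, w)"
      "represents X1 s" "same_below k X X1" "X1 (scratch k) = eval e s"
    using ecomp_correct[of P pc e k X s w] by auto
  let ?X = "X1(scratch (Suc k) := 0, addr (Var x) := eval e s)"
  have "steps P (etime e + 2) (pc, X, w) (pc + etime e + 2, ?X, w)"
    by (rule steps_trans[OF X1(1)]) (use Assign.prems X1(4) in auto)
  moreover have "represents ?X (s(Var x := eval e s))"
    using X1(2) by (intro represents_update) simp
  moreover have "same_below k X ?X" using X1(3) by simp
  ultimately show ?case unfolding time.simps csize.simps run.simps add.assoc by blast
next
  case (Put a e f)
  from Put.prems obtain X1 where X1: "steps P (etime e) (pc, X, w) (pc + etime e, X1, w)"
      "represents X1 s" "same_below k X X1" "X1 (scratch k) = eval e s"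
    using ecomp_correct[of P pc e k X s w] by auto
  define X2 where "X2 = X1(scratch k := addr (Elem a (eval e s)), scratch (Suc k) := bank a)"
  have X2: "represents X2 s" "same_below k X1 X2"
    using X1(2) by (simp_all add: X2_def)
  have "steps P 5 (pc + etime e, X1, w) (pc + etime e + 5, X2, w)"
    unfolding X2_def X1(4)[symmetric] using Put.prems(1) by (intro locate_correct) simp
  note st = steps_trans[OF X1(1) this]
  from Put.prems X2(1) obtain X3 where X3:
      "steps P (etime f) (pc + etime e + 5, X2, w) (pc + etime e + 5 + etime f, X3, w)"
      "represents X3 s" "same_below (Suc k) X2 X3" "X3 (scratch (Suc k)) = eval f s"
    using ecomp_correct[of P "pc + etime e + 5" f "Suc k" X2 s w] by (auto simp: ac_simps numeral_eq_Suc)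
  have k: "X3 (scratch k) = addr (Elem a (eval e s))"
    using same_below_D[OF X3(3), of k] by (simp add: X2_def)
  let ?X = "X3(addr (Elem a (eval e s)) := eval f s)"
  have "steps P (etime e + 5 + etime f + 1) (pc, X, w) (pc + etime e + 5 + etime f + 1, ?X, w)"
    by (rule steps_trans[OF steps_trans[OF st X3(1)]])
      (use Put.prems X3(4) k in \<open>auto simp: ac_simps numeral_eq_Suc\<close>)
  then have "steps P (time (Put a e f) s) (pc, X, w) (pc + csize (Put a e f), ?X, w)"
    by (simp add: ac_simps)
  moreover have "represents ?X (run (Put a e f) s)"
    using X3(2) by auto
  moreover have "same_below k X ?X"
    using X1(3) X2(2) same_below_mono[OF X3(3), of k] by (auto intro: same_below_trans)
  ultimately show ?case by blast
next
  case (Seq c c')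
  from Seq.prems obtain X1 where X1: "steps P (time c s) (pc, X, w) (pc + csize c, X1, w)"
      "represents X1 (run c s)" "same_below k X X1"
    using Seq.IH(1)[of pc k X s] by auto
  from Seq.prems X1(2) obtain X2 where X2:
      "steps P (time c' (run c s)) (pc + csize c, X1, w) (pc + csize c + csize c', X2, w)"
      "represents X2 (run c' (run c s))" "same_below k X1 X2"
    using Seq.IH(2)[of "pc + csize c" k X1 "run c s"] by auto
  show ?case using steps_trans[OF X1(1) X2(1)] X2(2) same_below_trans[OF X1(3) X2(3)]
    by (auto simp: add.assoc)
next
  case (IfPos e c c')
  from IfPos.prems obtain X1 where X1: "steps P (etime e) (pc, X, w) (pc + etime e, X1, w)"
      "represents X1 s" "same_below k X X1" "X1 (scratch k) = eval e s"
    using ecomp_correct[of P pc e k X s w] by auto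
  show ?case
  proof (cases "eval e s > 0")
    case True
    let ?pc = "pc + etime e + csize c' + 3"
    from IfPos.prems X1(2) obtain X2 where X2:
        "steps P (time c s) (?pc, X1, w) (?pc + csize c, X2, w)"
        "represents X2 (run c s)" "same_below k X1 X2"
      using IfPos.IH(1)[of ?pc k X1 s] by (auto simp: ac_simps numeral_eq_Suc)
    have "steps P 1 (pc + etime e, X1, w) (?pc, X1, w)"
      using IfPos.prems X1(4) True by auto
    from steps_trans[OF steps_trans[OF X1(1) this] X2(1)] show ?thesis
      using True X2(2) same_below_trans[OF X1(3) X2(3)]
      by (auto simp: ac_simps numeral_eq_Suc)
  next
    case False
    let ?pc = "pc + etime e + 1"
    from IfPos.prems X1(2) obtain X2 where X2:
        "steps P (time c' s) (?pc, X1, w) (?pc + csize c', X2, w)"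
        "represents X2 (run c' s)" "same_below k X1 X2"
      using IfPos.IH(2)[of ?pc k X1 s] by (auto simp: ac_simps numeral_eq_Suc)
    let ?X = "X2(scratch k := 1)"
    have "steps P 1 (pc + etime e, X1, w) (?pc, X1, w)"
      using IfPos.prems X1(4) False by auto
    note st = steps_trans[OF steps_trans[OF X1(1) this] X2(1)]
    have "steps P 2 (?pc + csize c', X2, w) (pc + etime e + csize c' + csize c + 3, ?X, w)"
      using IfPos.prems by (auto simp: ac_simps numeral_eq_Suc)
    from steps_trans[OF st this] False
    have "steps P (time (IfPos e c c') s) (pc, X, w) (pc + csize (IfPos e c c'), ?X, w)"
      by (simp add: ac_simps)
    moreover have "represents ?X (run (IfPos e c c') s)" "same_below k X ?X"
      using False X2(2) same_below_trans[OF X1(3) X2(3)] by simp_all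
    ultimately show ?thesis by blast
  qed
next
  case (For x y c)
  define n where "n = s (Var y)"
  define S where "S i = iter (\<lambda>i s. run c (s(Var x := i))) i s" for i
  have S_Suc: "S (Suc i) = run c ((S i)(Var x := i))" for i by (simp add: S_def)
  define t where "t i = (\<Sum>j<i. 7 + time c ((S j)(Var x := j)))" for i
  have code: "code_at P (pc + 8) (ccomp c (k + 2) (pc + 8))"
    using For.prems(1) by (simp add: ac_simps numeral_eq_Suc)
  \<comment> \<open>Invariant at the loop head \<open>pc + 3\<close>: the state after
    \<open>i\<close> rounds, with both counters. The body is compiled at level \<open>k + 2\<close>,
    so the counters in \<open>scratch k\<close> and \<open>scratch (Suc k)\<close> survive
    it.\<close>
  have loop: "\<exists>X'. steps P (3 + t i) (pc, X, w) (pc + 3, X', w) \<and> represents X' (S i) \<and>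
      same_below k X X' \<and> X' (scratch k) = n - i \<and> X' (scratch (Suc k)) = i" if "i \<le> n" for i
    using that
  proof (induction i)
    case 0
    have "X (addr (Var y)) = n" unfolding n_def using For.prems(2) by (rule represents_addr)
    let ?X = "X(scratch k := n, scratch (Suc k) := 0)"
    from 0 \<open>X (addr (Var y)) = n\<close> have "steps P 3 (pc, X, w) (pc + 3, ?X, w)"
      using For.prems by (auto simp: numeral_eq_Suc)
    then have "steps P (3 + t 0) (pc, X, w) (pc + 3, ?X, w)"
      by (simp only: t_def lessThan_0 sum.empty add_0_right)
    moreover have "represents ?X (S 0)" "same_below k X ?X" "?X (scratch k) = n - 0"
        "?X (scratch (Suc k)) = 0"
      using For.prems(2) by (simp_all add: S_def)
    ultimately show ?case by blast
  next
    case (Suc i)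
    then obtain X1 where X1: "steps P (3 + t i) (pc, X, w) (pc + 3, X1, w)" "represents X1 (S i)"
        "same_below k X X1" "X1 (scratch k) = n - i" "X1 (scratch (Suc k)) = i"
      by auto
    define X2 where "X2 = X1(scratch (k + 2) := 0, addr (Var x) := i)"
    have X2: "represents X2 ((S i)(Var x := i))" "same_below (k + 2) X1 X2"
      unfolding X2_def using X1(2) by auto
    have st1: "steps P 3 (pc + 3, X1, w) (pc + 8, X2, w)"
      using For.prems(1) X1(4,5) Suc.prems by (auto simp: X2_def numeral_eq_Suc)
    from For.IH[OF code X2(1)] obtain X3 where X3:
        "steps P (time c ((S i)(Var x := i))) (pc + 8, X2, w) (pc + 8 + csize c, X3, w)"
        "represents X3 (S (Suc i))" "same_below (k + 2) X2 X3"
      unfolding S_Suc by blast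
    have sb: "same_below (k + 2) X1 X3" using X2(2) X3(3) by (rule same_below_trans)
    have k: "X3 (scratch k) = n - i" "X3 (scratch (Suc k)) = i"
      using same_below_D[OF sb, of k] same_below_D[OF sb, of "Suc k"] X1(4,5) by auto
    let ?X = "X3(scratch (k + 2) := 1, scratch k := n - Suc i, scratch (Suc k) := Suc i)"
    have "steps P 4 (pc + 8 + csize c, X3, w) (pc + 3, ?X, w)"
      using For.prems(1) k by (auto simp: numeral_eq_Suc)
    from steps_trans[OF steps_trans[OF steps_trans[OF X1(1) st1] X3(1)] this]
    have "steps P (3 + t (Suc i)) (pc, X, w) (pc + 3, ?X, w)"
      by (simp add: t_def ac_simps)
    moreover have "same_below k X ?X"
      using same_below_trans[OF X1(3) same_below_mono[OF sb, of k]] by simp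
    moreover have "represents ?X (S (Suc i))" "?X (scratch k) = n - Suc i"
        "?X (scratch (Suc k)) = Suc i"
      using X3(2) by simp_all
    ultimately show ?case by blast
  qed
  from loop[of n] obtain X1 where X1: "steps P (3 + t n) (pc, X, w) (pc + 3, X1, w)"
      "represents X1 (S n)" "same_below k X X1" "X1 (scratch k) = 0"
    by auto
  let ?X = "X1(scratch (k + 2) := 1)"
  have "steps P 3 (pc + 3, X1, w) (pc + csize c + 12, ?X, w)"
    using For.prems(1) X1(4) by (auto simp: ac_simps numeral_eq_Suc)
  from steps_trans[OF X1(1) this]
  have "steps P (time (For x y c) s) (pc, X, w) (pc + csize c + 12, ?X, w)"
    by (simp add: t_def S_def n_def ac_simps)
  then have "steps P (time (For x y c) s) (pc, X, w) (pc + csize (For x y c), ?X, w)"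
    by (simp only: csize.simps add.assoc)
  moreover have "represents ?X (run (For x y c) s)" "same_below k X ?X"
    using X1(2,3) by (simp_all add: S_def n_def)
  ultimately show ?case by blast
qed

section \<open>Complete programs: reading symbol by symbol, then computing\<close>

definition read_input :: "com \<Rightarrow> symbol list \<Rightarrow> state \<Rightarrow> state" where
  "read_input c w = fold (\<lambda>a s. run c (s(Var Symbol := code a))) w"

lemma read_input_simps [simp]:
  "read_input c [] s = s"
  "read_input c (a # w) s = read_input c w (run c (s(Var Symbol := code a)))"
  "read_input c (v @ w) s = read_input c w (read_input c v s)"
  by (simp_all add: read_input_def)

text \<open>Codes of symbols are positive, so a 0 delivered by \<open>Read\<close> can only mean the
  end of the input.\<close>

definition read_comp :: "com \<Rightarrow> program" where
  "read_comp c =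
     [Read (scratch 0), JumpPos (scratch 0) 4] @ jump 1 (csize c + 8) @
     [Const (scratch 1) 0, Add (addr (Var Symbol)) (scratch 0) (scratch 1)] @ ccomp c 0 6 @
     jump 0 0"

definition program :: "com \<Rightarrow> com \<Rightarrow> program" where
  "program c c' =
     read_comp c @ ccomp c' 0 (csize c + 8) @ ecomp (Get Ans) 0 @
     [JumpPos (scratch 0) (csize c + csize c' + 12), Halt False, Halt True]"

lemma length_read_comp [simp]: "length (read_comp c) = csize c + 8"
  by (simp add: read_comp_def)

lemma code_pos [simp]: "0 < code a"
  by (cases a rule: code.cases) auto

text \<open>Per symbol, four instructions precede the body and two follow it; the round that finds
  the input exhausted takes four.\<close>

lemma read_comp_correct:
  assumes "code_at P 0 (read_comp c)" "represents X s" "\<And>s. time c s \<le> K"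
  shows "\<exists>k X' w'. steps P k (0, X, w) (csize c + 8, X', w') \<and>
    represents X' (read_input c w s) \<and> k \<le> length w * (K + 6) + 4"
  using assms(2)
proof (induction w arbitrary: X s)
  case Nil
  let ?X = "X(scratch 0 := 0, scratch 1 := 1)"
  have "steps P 4 (0, X, []) (csize c + 8, ?X, [])"
    using assms(1) by (auto simp: read_comp_def numeral_eq_Suc)
  moreover have "represents ?X (read_input c [] s)" using Nil by simp
  ultimately show ?case
    by (metis le_add2)
next
  case (Cons a w)
  define X1 where "X1 = X(scratch 0 := code a, scratch 1 := 0, addr (Var Symbol) := code a)"
  have "represents X1 (s(Var Symbol := code a))"
    unfolding X1_def using Cons.prems by (intro represents_update) simp
  moreover have "code_at P 6 (ccomp c 0 6)"
    using assms(1) by (auto simp: read_comp_def numeral_eq_Suc)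
  ultimately obtain X2 where X2:
      "steps P (time c (s(Var Symbol := code a))) (6, X1, w) (6 + csize c, X2, w)"
      "represents X2 (run c (s(Var Symbol := code a)))"
    using ccomp_correct by blast
  let ?X = "X2(scratch 0 := 1)"
  have st1: "steps P 4 (0, X, a # w) (6, X1, w)"
    using assms(1) by (auto simp: read_comp_def X1_def numeral_eq_Suc)
  have st2: "steps P 2 (6 + csize c, X2, w) (0, ?X, w)"
    using assms(1) by (auto simp: read_comp_def numeral_eq_Suc)
  have "represents ?X (run c (s(Var Symbol := code a)))"
    using X2(2) by simp
  from Cons.IH[OF this] obtain k X' w' where k:
      "steps P k (0, ?X, w) (csize c + 8, X', w')"
      "represents X' (read_input c w (run c (s(Var Symbol := code a))))"
      "k \<le> length w * (K + 6) + 4" by blast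
  let ?k = "4 + time c (s(Var Symbol := code a)) + 2 + k"
  have "steps P ?k (0, X, a # w) (csize c + 8, X', w')"
    using steps_trans[OF steps_trans[OF steps_trans[OF st1 X2(1)] st2] k(1)] .
  moreover have "?k \<le> length (a # w) * (K + 6) + 4"
    using k(3) assms(3)[of "s(Var Symbol := code a)"] by simp
  ultimately show ?case using k(2) unfolding read_input_simps by blast
qed

lemma program_correct:
  fixes w :: "symbol list"
  assumes "\<And>s. time c s \<le> K"
  defines "s \<equiv> read_input c w (\<lambda>_. 0)"
  shows "\<exists>k pc X' w'. steps (program c c') k (0, \<lambda>_. 0, w) (pc, X', w') \<and>
    pc < length (program c c') \<and> program c c' ! pc = Halt (run c' s (Var Ans) > 0) \<and>
    k \<le> length w * (K + 6) + time c' s + 7"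
proof -
  let ?P = "program c c'"
  let ?pc = "csize c + csize c' + 10"
  define P where "P = ?P"
  have code: "code_at P 0 (read_comp c @ ccomp c' 0 (csize c + 8) @ ecomp (Get Ans) 0 @
      [JumpPos (scratch 0) (csize c + csize c' + 12), Halt False, Halt True])"
    using code_at_self[of "[]" P "[]"]
    by (simp only: P_def program_def append_Nil append_Nil2 list.size)
  have rep: "represents (\<lambda>_. 0) (\<lambda>_. 0)" by (simp add: represents_def)
  have "code_at P 0 (read_comp c)"
    using code by simp
  from read_comp_correct[OF this rep assms(1)] obtain k X1 w1 where k:
      "steps P k (0, \<lambda>_. 0, w) (csize c + 8, X1, w1)" "represents X1 s"
      "k \<le> length w * (K + 6) + 4"
    unfolding s_def by blast
  have "code_at P (csize c + 8) (ccomp c' 0 (csize c + 8))"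
    using code by simp
  from ccomp_correct[OF this k(2)] obtain X2 where X2:
      "steps P (time c' s) (csize c + 8, X1, w1) (csize c + 8 + csize c', X2, w1)"
      "represents X2 (run c' s)" by blast
  have code2: "code_at P (csize c + 8 + csize c') (ecomp (Get Ans) 0 @
      [JumpPos (scratch 0) (csize c + csize c' + 12), Halt False, Halt True])"
    using code by (simp add: ac_simps)
  then have "code_at P (csize c + 8 + csize c') (ecomp (Get Ans) 0)"
    by (simp only: code_at_append)
  from ecomp_correct[OF this X2(2), of w1]
  obtain X3 where "steps P (etime (Get Ans)) (csize c + 8 + csize c', X2, w1)
      (csize c + 8 + csize c' + etime (Get Ans), X3, w1)"
      "X3 (scratch 0) = eval (Get Ans) (run c' s)" by blast
  moreover have "csize c + 8 + csize c' + etime (Get Ans) = ?pc" "etime (Get Ans) = 2" by simp_all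
  ultimately have X3:
      "steps P 2 (csize c + 8 + csize c', X2, w1) (?pc, X3, w1)"
      "X3 (scratch 0) = run c' s (Var Ans)" by (simp_all only: eval.simps)
  define pc where "pc = (if run c' s (Var Ans) > 0 then ?pc + 2 else ?pc + 1)"
  have st: "steps P 1 (?pc, X3, w1) (pc, X3, w1)"
    using code2 X3(2) by (auto simp: pc_def numeral_eq_Suc)
  have "pc < length P" "P ! pc = Halt (run c' s (Var Ans) > 0)"
    using code2 by (auto simp: pc_def numeral_eq_Suc)
  moreover have "k + time c' s + 2 + 1 \<le> length w * (K + 6) + time c' s + 7"
    using k(3) by simp
  ultimately show ?thesis unfolding P_def[symmetric]
    using steps_trans[OF steps_trans[OF steps_trans[OF k(1) X2(1)] X3(1)] st] by blast
qed


section \<open>Polynomial running times\<close>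

primrec writes :: "com \<Rightarrow> var set" where
  "writes Skip = {}"
| "writes (x ::= e) = {x}"
| "writes (Put a e f) = {}"
| "writes (c ;; c') = writes c \<union> writes c'"
| "writes (IfPos e c c') = writes c \<union> writes c'"
| "writes (For x y c) = insert x (writes c)"

primrec puts :: "com \<Rightarrow> arr set" where
  "puts Skip = {}"
| "puts (x ::= e) = {}"
| "puts (Put a e f) = {a}"
| "puts (c ;; c') = puts c \<union> puts c'"
| "puts (IfPos e c c') = puts c \<union> puts c'"
| "puts (For x y c) = puts c"

primrec limits :: "com \<Rightarrow> var set" where
  "limits Skip = {}"
| "limits (x ::= e) = {}"
| "limits (Put a e f) = {}"
| "limits (c ;; c') = limits c \<union> limits c'"
| "limits (IfPos e c c') = limits c \<union> limits c'"
| "limits (For x y c) = insert y (limits c)"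

text \<open>The indeterminate stands for a common bound on all loop limits, so each loop multiplies
  by it. The branches of a conditional are added, which replaces a maximum.\<close>

primrec tpoly :: "com \<Rightarrow> nat poly" where
  "tpoly Skip = 0"
| "tpoly (x ::= e) = [:etime e + 2:]"
| "tpoly (Put a e f) = [:etime e + etime f + 6:]"
| "tpoly (c ;; c') = tpoly c + tpoly c'"
| "tpoly (IfPos e c c') = [:etime e + 3:] + tpoly c + tpoly c'"
| "tpoly (For x y c) = [:6:] + [:0, 1:] * ([:7:] + tpoly c)"

lemma run_Var: "x \<notin> writes c \<Longrightarrow> run c s (Var x) = s (Var x)"
proof (induction c arbitrary: s)
  case (For y z c)
  have "iter (\<lambda>i s. run c (s(Var y := i))) n s (Var x) = s (Var x)" for n
    using For by (induction n) auto
  then show ?case by simp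
qed auto

lemma run_Elem: "a \<notin> puts c \<Longrightarrow> run c s (Elem a i) = s (Elem a i)"
proof (induction c arbitrary: s)
  case (For y z c)
  have "iter (\<lambda>i s. run c (s(Var y := i))) n s (Elem a i) = s (Elem a i)" for n
    using For by (induction n) auto
  then show ?case by simp
qed auto

text \<open>Loop limits that the loop bodies leave unchanged make the running time a polynomial that can
  be read off the program text.\<close>

lemma time_le_tpoly:
  assumes "limits c \<subseteq> Y" "writes c \<inter> Y = {}" "\<And>y. y \<in> Y \<Longrightarrow> s (Var y) \<le> N"
  shows "time c s \<le> poly (tpoly c) N"
  using assms
proof (induction c arbitrary: s)
  case (Seq c c')
  have "run c s (Var y) = s (Var y)" if "y \<in> Y" for y
    using Seq.prems(2) that by (intro run_Var) auto
  then have "time c' (run c s) \<le> poly (tpoly c') N"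
    using Seq.prems by (intro Seq.IH(2)) auto
  moreover have "time c s \<le> poly (tpoly c) N"
    using Seq.prems by (intro Seq.IH(1)) auto
  ultimately show ?case by simp
next
  case (IfPos e c c')
  have "time c s \<le> poly (tpoly c) N" "time c' s \<le> poly (tpoly c') N"
    using IfPos.prems by (auto intro!: IfPos.IH)
  then show ?case by simp
next
  case (For x y c)
  define S where "S i = iter (\<lambda>i s. run c (s(Var x := i))) i s" for i
  have S: "S i (Var z) = s (Var z)" if "z \<in> Y" for i z
  proof -
    have "z \<notin> writes c" "z \<noteq> x" using For.prems(2) that by auto
    then show ?thesis unfolding S_def by (induction i) (simp_all add: run_Var)
  qed
  have "time c ((S i)(Var x := i)) \<le> poly (tpoly c) N" for i
    using For.prems S by (intro For.IH) auto
  then have "(\<Sum>i<s (Var y). 7 + time c ((S i)(Var x := i))) \<le> s (Var y) * (7 + poly (tpoly c) N)"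
    using sum_bounded_above[of "{..<s (Var y)}" "\<lambda>i. 7 + time c ((S i)(Var x := i))"] by simp
  also have "\<dots> \<le> N * (7 + poly (tpoly c) N)"
    using For.prems by (intro mult_right_mono) auto
  finally show ?case by (simp add: S_def)
qed auto

theorem program_answers_within:
  assumes "limits c = {}"
    and "\<And>w. w \<in> W \<Longrightarrow> time c' (read_input c w (\<lambda>_. 0)) \<le> poly q (length w)"
  shows "\<exists>p. \<forall>w \<in> W. answers_within (program c c') w (poly p (length w))
    (run c' (read_input c w (\<lambda>_. 0)) (Var Ans) > 0)"
proof -
  let ?P = "program c c'"
  \<comment> \<open>Without loops no limit has to be bounded, so 0 serves as the common bound and
    \<open>K\<close> does not depend on the state.\<close>
  define K where "K = poly (tpoly c) 0"
  have K: "time c s \<le> K" for s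
    unfolding K_def using assms(1) by (intro time_le_tpoly[of c "{}"]) auto
  \<comment> \<open>The sum dominates every constant in the program, and \<open>n < 2 ^ n\<close>;
    the 2 meets the requirement \<open>2 \<le> B\<close>. Initially all registers are 0.\<close>
  define B where "B = (\<Sum>i\<leftarrow>?P. literal i) + 2"
  have B: "literal i < 2 ^ B" if "i \<in> set ?P" for i
  proof -
    have "literal i \<le> (\<Sum>i\<leftarrow>?P. literal i)" using that by (simp add: member_le_sum_list)
    also have "\<dots> < B" by (simp add: B_def)
    also have "B < 2 ^ B" by simp
    finally show ?thesis .
  qed
  \<comment> \<open>\<open>r\<close> bounds the number of steps; \<open>p\<close> is the cost bound
    \<open>Suc k * (2 * (B + k))\<close> with \<open>k\<close> replaced by \<open>r\<close>.\<close>
  define r where "r = [:7, K + 6:] + q"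
  define p where "p = ([:1:] + r) * (smult 2 ([:B:] + r))"
  show ?thesis
  proof (intro exI[of _ p] ballI)
    fix w assume w: "w \<in> W"
    let ?s = "read_input c w (\<lambda>_. 0)"
    obtain k pc X' w' where k: "steps ?P k (0, \<lambda>_. 0, w) (pc, X', w')" "pc < length ?P"
        "?P ! pc = Halt (run c' ?s (Var Ans) > 0)" "k \<le> length w * (K + 6) + time c' ?s + 7"
      using program_correct[OF K] by blast
    have run: "\<exists>T\<le>Suc k * (2 * (B + k)). runs ?P (0, \<lambda>_. 0, w) T (run c' ?s (Var Ans) > 0)"
      by (rule steps_runs[OF k(1-3)]) (use B in \<open>auto simp: B_def\<close>)
    have kr: "k \<le> poly r (length w)"
      using k(4) assms(2)[OF w] by (simp add: r_def algebra_simps)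
    have "Suc k * (2 * (B + k)) \<le> Suc (poly r (length w)) * (2 * (B + poly r (length w)))"
      using kr by (intro mult_le_mono) auto
    also have "\<dots> = poly p (length w)" by (simp add: p_def)
    finally have "Suc k * (2 * (B + k)) \<le> poly p (length w)" .
    with run show "answers_within ?P w (poly p (length w)) (run c' ?s (Var Ans) > 0)"
      unfolding answers_within_def using le_trans by blast
  qed
qed

section \<open>Reading the input\<close>

text \<open>\<open>Power\<close> holds one less than the current power of two, since registers are initially 0.\<close>

definition tokenize :: com where
  "tokenize =
     IfPos (Get Symbol [-] Num 2)
       (Put Values (Get Tok) (Get Value) ;; Put Counts (Get Tok) (Get Count) ;;
        Tok ::= Get Tok [+] Num 1 ;; Value ::= Num 0 ;; Count ::= Num 0 ;; Power ::= Num 0)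
       (IfPos (Get Symbol [-] Num 1) (Value ::= Get Value [+] Get Power [+] Num 1) Skip ;;
        Count ::= Get Count [+] Num 1 ;; Power ::= Get Power [+] Get Power [+] Num 1)"

definition token :: "bool list \<Rightarrow> symbol list" where
  "token bs = map Bit bs @ [Sep]"

text \<open>While reading, unary and binary numbers look alike. Each token is therefore stored both
  as a binary value and as a length; its position later decides which of the two is meant.\<close>

definition tokenized :: "bool list list \<Rightarrow> state \<Rightarrow> bool" where
  "tokenized ts s \<longleftrightarrow> s (Var Tok) = length ts \<and>
     s (Var Value) = 0 \<and> s (Var Power) = 0 \<and> s (Var Count) = 0 \<and>
     (\<forall>k < length ts. s (Elem Values k) = horner_sum of_bool 2 (ts ! k) \<and>
        s (Elem Counts k) = length (ts ! k))"

text \<open>Stated for reading to start in the middle of a token, where the next bit has weight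
  \<open>2 ^ j\<close>; this is the form that induction on the bits needs.\<close>

lemma read_bits:
  assumes "Suc (s (Var Power)) = 2 ^ j" "s' = read_input tokenize (map Bit bs) s"
  shows "s' (Var Value) = s (Var Value) + 2 ^ j * horner_sum of_bool 2 bs"
    "s' (Var Count) = s (Var Count) + length bs" "s' (Var Tok) = s (Var Tok)"
    "s' (Elem a i) = s (Elem a i)"
proof -
  have "s' (Var Value) = s (Var Value) + 2 ^ j * horner_sum of_bool 2 bs \<and>
    s' (Var Count) = s (Var Count) + length bs \<and> s' (Var Tok) = s (Var Tok) \<and>
    (\<forall>a i. s' (Elem a i) = s (Elem a i))"
    using assms
  proof (induction bs arbitrary: s j)
    case (Cons b bs)
    define s1 where "s1 = run tokenize (s(Var Symbol := code (Bit b)))"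
    have s1: "s1 (Var Value) = s (Var Value) + 2 ^ j * of_bool b"
      "s1 (Var Count) = s (Var Count) + 1" "s1 (Var Tok) = s (Var Tok)"
      "s1 (Elem a i) = s (Elem a i)" "Suc (s1 (Var Power)) = 2 ^ Suc j" for a i
      using Cons.prems(1) by (cases b; simp add: s1_def tokenize_def; fail)+
    show ?case
      using Cons.IH[of s1, OF s1(5)] Cons.prems(2) s1(1-4)
      by (simp add: s1_def algebra_simps)
  qed simp
  then show "s' (Var Value) = s (Var Value) + 2 ^ j * horner_sum of_bool 2 bs"
    "s' (Var Count) = s (Var Count) + length bs" "s' (Var Tok) = s (Var Tok)"
    "s' (Elem a i) = s (Elem a i)" by blast+
qed

lemma tokenized_token:
  assumes "tokenized ts s"
  shows "tokenized (ts @ [bs]) (read_input tokenize (token bs) s)"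
proof -
  define s' where "s' = read_input tokenize (map Bit bs) s"
  have s: "s (Var Value) = 0" "s (Var Count) = 0" "s (Var Tok) = length ts"
    "Suc (s (Var Power)) = 2 ^ 0"
    using assms by (simp_all add: tokenized_def)
  note s' = read_bits[OF s(4) s'_def]
  have "read_input tokenize (token bs) s = run tokenize (s'(Var Symbol := 3))"
    by (simp add: token_def s'_def)
  moreover have "tokenized (ts @ [bs]) \<dots>"
    using s s' assms by (auto simp: tokenized_def tokenize_def nth_append less_Suc_eq)
  ultimately show ?thesis by simp
qed

lemma read_tokens:
  "tokenized ts s \<Longrightarrow> tokenized (ts @ us) (read_input tokenize (concat (map token us)) s)"
proof (induction us arbitrary: ts s)
  case (Cons u us)
  then show ?case using Cons.IH[OF tokenized_token[OF Cons.prems, of u]] by simp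
qed simp

lemma horner_sum_bits: "horner_sum of_bool 2 (bits n) = n"
proof (induction n rule: less_induct)
  case (less n)
  show ?case
  proof (cases "n = 0")
    case False
    then have "horner_sum of_bool 2 (bits (n div 2)) = n div 2" by (intro less.IH) simp
    with False show ?thesis by (simp add: bits.simps[of n])
  qed (simp add: bits.simps)
qed

lemma binary_token: "binary n = token (bits n)"
  by (simp add: binary_def token_def)

lemma unary_token: "unary n = token (replicate n True)"
  by (simp add: unary_def token_def)

definition list_tokens :: "('a \<Rightarrow> bool list list) \<Rightarrow> 'a list \<Rightarrow> bool list list" where
  "list_tokens f xs = bits (length xs) # concat (map f xs)"

lemma enc_list_tokens:
  assumes "\<And>x. f x = concat (map token (g x))"
  shows "enc_list f xs = concat (map token (list_tokens g xs))"
proof -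
  have "concat (map f xs) = concat (map token (concat (map g xs)))"
    by (induction xs) (simp_all add: assms)
  then show ?thesis by (simp add: enc_list_def list_tokens_def binary_token)
qed

definition nat_tokens :: "nat list \<Rightarrow> bool list list" where
  "nat_tokens = list_tokens (\<lambda>n. [bits n])"

definition tokens :: "nat list \<Rightarrow> nat bribery \<Rightarrow> bool list list" where
  "tokens \<alpha> I =
     list_tokens (\<lambda>n. [replicate n True]) \<alpha> @ list_tokens nat_tokens (votes I) @
     [bits (despised I), bits (budget I)] @
     list_tokens nat_tokens (map finite_prices (prices I))"

lemma encode_tokens: "encode \<alpha> I = concat (map token (tokens \<alpha> I))"
proof -
  have u: "enc_list unary xs = concat (map token (list_tokens (\<lambda>n. [replicate n True]) xs))" for xs
    by (rule enc_list_tokens) (simp add: unary_token)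
  have "enc_list binary xs = concat (map token (nat_tokens xs))" for xs
    unfolding nat_tokens_def by (rule enc_list_tokens) (simp add: binary_token)
  then have b: "enc_list (enc_list binary) xs = concat (map token (list_tokens nat_tokens xs))" for xs
    by (rule enc_list_tokens)
  show ?thesis by (simp add: encode_def tokens_def u b binary_token)
qed

lemma length_concat_token: "length ts \<le> length (concat (map token ts))"
  by (induction ts) (simp_all add: token_def)

lemma nth_concat:
  "i < length xss \<Longrightarrow> j < length (xss ! i) \<Longrightarrow>
     concat xss ! (sum_list (map length (take i xss)) + j) = xss ! i ! j"
proof (induction xss arbitrary: i)
  case (Cons xs xss)
  then show ?case by (cases i) (auto simp: nth_append)
qed simp

lemma nat_tokens_simps:
  "length (nat_tokens xs) = Suc (length xs)"
  "nat_tokens xs ! 0 = bits (length xs)"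
  "j < length xs \<Longrightarrow> nat_tokens xs ! Suc j = bits (xs ! j)"
proof -
  have "concat (map (\<lambda>n. [bits n]) xs) = map bits xs" by (induction xs) auto
  then show "length (nat_tokens xs) = Suc (length xs)"
    "nat_tokens xs ! 0 = bits (length xs)"
    "j < length xs \<Longrightarrow> nat_tokens xs ! Suc j = bits (xs ! j)"
    by (auto simp: nat_tokens_def list_tokens_def)
qed

text \<open>The leading 1 is the token of the outer length, and each \<open>Suc\<close> counts the
  length token in front of an inner list. Offset 0 in a block is thus the length, and entries start
  at offset 1.\<close>

lemma nth_list_tokens:
  assumes "i < length xss" "j \<le> length (xss ! i)"
  shows "list_tokens nat_tokens xss ! (1 + (\<Sum>k<i. Suc (length (xss ! k))) + j) =
    bits (case j of 0 \<Rightarrow> length (xss ! i) | Suc j \<Rightarrow> xss ! i ! j)"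
proof -
  have "sum_list (map length (take i (map nat_tokens xss))) = (\<Sum>k<i. Suc (length (xss ! k)))"
    using assms(1)
    by (auto simp: sum_list_sum_nth nat_tokens_simps atLeast0LessThan intro!: sum.cong)
  moreover have "concat (map nat_tokens xss) ! (sum_list (map length (take i (map nat_tokens xss))) + j) =
      nat_tokens (xss ! i) ! j"
    using nth_concat[of i "map nat_tokens xss" j] assms by (simp add: nat_tokens_simps)
  ultimately show ?thesis using assms(2)
    by (cases j) (simp_all add: list_tokens_def nat_tokens_simps)
qed

lemma length_list_tokens:
  "length (list_tokens nat_tokens xss) = 1 + (\<Sum>k<length xss. Suc (length (xss ! k)))"
  by (simp add: list_tokens_def length_concat comp_def nat_tokens_simps sum_list_sum_nth
      atLeast0LessThan)

section \<open>The search program\<close>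

text \<open>One of the two truncated differences always vanishes, so this is the absolute
  difference: positive exactly if the values differ.\<close>

abbreviation apart :: "expr \<Rightarrow> expr \<Rightarrow> expr" where
  "apart e f \<equiv> (e [-] f) [+] (f [-] e)"

definition places :: com where
  "places =
     For Place Cands
       (IfPos (apart (At Values (Get Vote [+] Get Place)) (Get Despised)) Skip
          (PosD ::= Get Place) ;;
        IfPos (apart (At Values (Get Vote [+] Get Place)) (Get Cand)) Skip
          (PosC ::= Get Place))"

text \<open>Places count from 0 and token 0 is a length, so the entry for place j is the length of
  token j + 1. The rival moves up by one exactly if \<open>d\<close> passes it. The top entry is
  added before the new score of \<open>d\<close> is subtracted, so that truncation does no
  harm.\<close>

definition gains :: com where
  "gains =
     For Shift Cands
       (Acc ::= Get PosC ;;
        IfPos (Get PosC [-] Get PosD)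
          (IfPos (Get PosD [+] Get Shift [+] Num 1 [-] Get PosC) (Acc ::= Get PosC [-] Num 1) Skip)
          Skip ;;
        Put Gain (Get Shift)
          (At Counts (Num 1 [+] Get Acc) [+] At Counts (Num 1) [-]
             At Counts (Num 1 [+] (Get PosD [+] Get Shift))))"

text \<open>Costs are capped at one more than the budget, which also marks unreachable totals.\<close>

definition relax :: com where
  "relax =
     For Total Width
       (Acc ::= Get Budget [+] Num 1 ;;
        For Shift Cands
          (IfPos (At Values (Get Price) [-] Get Shift)
             (IfPos (Get Total [+] Num 1 [-] At Gain (Get Shift))
                (IfPos (Get Acc [-] (At Best (Get Total [-] At Gain (Get Shift)) [+]
                    At Values (Get Price [+] Num 1 [+] Get Shift)))
                   (Acc ::= At Best (Get Total [-] At Gain (Get Shift)) [+]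
                      At Values (Get Price [+] Num 1 [+] Get Shift))
                   Skip)
                Skip)
             Skip) ;;
        Put Next (Get Total) (Get Acc))"

text \<open>Each voter contributes exactly one shift. Updating \<open>Best\<close> in place could
  combine two shifts of the same voter, hence the second array.\<close>

definition copy :: com where
  "copy = For Total Width (Put Best (Get Total) (At Next (Get Total)))"

definition voter :: com where
  "voter =
     places ;; gains ;; relax ;; copy ;;
     Vote ::= Get Vote [+] Get Cands [+] Num 1 ;;
     Price ::= Get Price [+] At Values (Get Price) [+] Num 1"

text \<open>Loops have no early exit; instead \<open>Ans\<close> is only ever raised to 1, so over
  all rivals it accumulates a disjunction.\<close>

definition challenge :: com where
  "challenge =
     For Total Width (Put Best (Get Total) (Get Budget [+] Num 1)) ;;
     Put Best (Num 0) (Num 0) ;;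
     Vote ::= Get Cands [+] Num 3 ;; Price ::= Get Start ;;
     For Voter Voters voter ;;
     For Total Width
       (IfPos (Get Total [+] Num 1 [-] Get Target)
          (IfPos (Get Budget [+] Num 1 [-] At Best (Get Total)) (Ans ::= Num 1) Skip)
          Skip)"

definition search :: com where
  "search =
     For Number Cands
       (Cand ::= Get Number [+] Num 1 ;;
        IfPos (apart (Get Cand) (Get Despised)) challenge Skip)"

lemma writes_simps [simp]:
  "writes places = {Place, PosD, PosC}" "puts places = {}"
  "writes gains = {Shift, Acc}" "puts gains = {Gain}"
  "writes relax = {Total, Shift, Acc}" "puts relax = {Next}"
  "writes copy = {Total}" "puts copy = {Best}"
  by (auto simp: places_def gains_def relax_def copy_def)

lemma writes_voter [simp]:
  "writes voter = {Place, PosD, PosC, Shift, Acc, Total, Vote, Price}"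
  "puts voter = {Gain, Next, Best}"
  by (auto simp: voter_def)

lemma writes_challenge [simp]:
  "writes challenge = {Place, PosD, PosC, Shift, Acc, Total, Vote, Price, Voter, Ans}"
  "puts challenge = {Gain, Next, Best}"
  by (auto simp: challenge_def)

lemma iter_invariant:
  assumes "P 0 s" "\<And>i s. i < n \<Longrightarrow> P i s \<Longrightarrow> P (Suc i) (f i s)"
  shows "P n (iter f n s)"
proof -
  have "i \<le> n \<Longrightarrow> P i (iter f i s)" for i
    by (induction i) (use assms in auto)
  then show ?thesis by simp
qed

text \<open>Multiple-choice knapsack in the form of the dynamic program: one option below
  \<open>N i\<close> for each index, total weight exactly \<open>s\<close>, total price at most
  \<open>b\<close>. The guards keep the truncated subtractions exact.\<close>

fun reach :: "(nat \<Rightarrow> nat) \<Rightarrow> (nat \<Rightarrow> nat \<Rightarrow> nat) \<Rightarrow> (nat \<Rightarrow> nat \<Rightarrow> nat) \<Rightarrow>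
    nat \<Rightarrow> nat \<Rightarrow> nat \<Rightarrow> bool" where
  "reach N g p 0 s b \<longleftrightarrow> s = 0"
| "reach N g p (Suc i) s b \<longleftrightarrow>
     (\<exists>t < N i. g i t \<le> s \<and> p i t \<le> b \<and> reach N g p i (s - g i t) (b - p i t))"

text \<open>The last index is peeled off. Conversely its option extends a choice for the others by
  \<open>t(n := u)\<close>, which leaves the sums below \<open>n\<close> unchanged.\<close>

lemma reach_iff:
  "reach N g p n s b \<longleftrightarrow>
     (\<exists>t. (\<forall>i<n. t i < N i) \<and> (\<Sum>i<n. g i (t i)) = s \<and> (\<Sum>i<n. p i (t i)) \<le> b)"
proof (induction n arbitrary: s b)
  case (Suc n)
  show ?case (is "?l \<longleftrightarrow> ?r")
  proof
    assume ?l
    then obtain u where u: "u < N n" "g n u \<le> s" "p n u \<le> b"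
        "reach N g p n (s - g n u) (b - p n u)" by auto
    then obtain t where t: "\<forall>i<n. t i < N i" "(\<Sum>i<n. g i (t i)) = s - g n u"
        "(\<Sum>i<n. p i (t i)) \<le> b - p n u" unfolding Suc by blast
    have "(\<Sum>i<n. h i ((t(n := u)) i)) = (\<Sum>i<n. h i (t i))" for h :: "nat \<Rightarrow> nat \<Rightarrow> nat"
      by (rule sum.cong) auto
    then show ?r using t u by (intro exI[of _ "t(n := u)"]) (auto simp: less_Suc_eq)
  next
    assume ?r
    then obtain t where t: "\<forall>i<Suc n. t i < N i" "(\<Sum>i<Suc n. g i (t i)) = s"
        "(\<Sum>i<Suc n. p i (t i)) \<le> b" by blast
    then have "reach N g p n (s - g n (t n)) (b - p n (t n))"
      unfolding Suc by (intro exI[of _ t]) auto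
    with t show ?l by (auto intro!: exI[of _ "t n"])
  qed
qed simp

section \<open>Correctness of the dynamic program\<close>

definition constants :: "var set" where
  "constants = {Cands, Voters, Target, Width, Budget, Despised, Start}"

text \<open>\<open>V\<close> and \<open>U\<close> give the values and the lengths of the tokens of the input. Token 0 is the number
  \<open>m\<close> of candidates, followed by the protocol, the number of votes, and the votes, each preceded by its
  length; the ranking of voter \<open>i\<close> thus starts at token \<open>m + 3 + i * (m + 1)\<close>. The list of prices of
  voter \<open>i\<close> starts with its length at token \<open>price i\<close>.\<close>

locale search_input =
  fixes V U :: "nat \<Rightarrow> nat" and m n target B d :: nat and price :: "nat \<Rightarrow> nat"
    and place :: "nat \<Rightarrow> nat \<Rightarrow> nat"
  assumes place: "i < n \<Longrightarrow> c \<in> {1..m} \<Longrightarrow> j < m \<Longrightarrow>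
      V (m + 3 + i * (m + 1) + j) = c \<longleftrightarrow> j = place i c"
    and place_less: "i < n \<Longrightarrow> c \<in> {1..m} \<Longrightarrow> place i c < m"
    and price: "i < n \<Longrightarrow> price (Suc i) = price i + V (price i) + 1"
    and prices_le: "i < n \<Longrightarrow> V (price i) \<le> m"
    and d: "d \<in> {1..m}"
begin

definition gain :: "nat \<Rightarrow> nat \<Rightarrow> nat \<Rightarrow> nat" where
  "gain pd pc t =
     U (1 + (if pd < pc \<and> pc \<le> pd + t then pc - 1 else pc)) + U 1 - U (1 + (pd + t))"

definition reachable :: "nat \<Rightarrow> nat \<Rightarrow> nat \<Rightarrow> nat \<Rightarrow> bool" where
  "reachable c = reach (\<lambda>i. V (price i)) (\<lambda>i. gain (place i d) (place i c))
     (\<lambda>i t. V (price i + 1 + t))"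

definition env :: "state \<Rightarrow> bool" where
  "env s \<longleftrightarrow> (\<forall>k. s (Elem Values k) = V k) \<and> (\<forall>k. s (Elem Counts k) = U k) \<and>
     s (Var Cands) = m \<and> s (Var Voters) = n \<and> s (Var Target) = target \<and>
     s (Var Width) = target + target + 1 \<and> s (Var Budget) = B \<and> s (Var Despised) = d \<and>
     s (Var Start) = price 0"

lemma env_upd_Var [simp]:
  assumes "x \<notin> constants"
  shows "env (s(Var x := v)) \<longleftrightarrow> env s"
proof -
  have "(s(Var x := v)) (Var y) = s (Var y)" if "y \<in> constants" for y using assms that by auto
  moreover have "(s(Var x := v)) (Elem a k) = s (Elem a k)" for a k by simp
  ultimately show ?thesis by (simp add: env_def constants_def del: fun_upd_apply)
qed

lemma env_upd_Elem [simp]: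
  assumes "a \<notin> {Values, Counts}"
  shows "env (s(Elem a i := v)) \<longleftrightarrow> env s"
proof -
  have "(s(Elem a i := v)) (Elem b k) = s (Elem b k)" if "b \<in> {Values, Counts}" for b k
    using assms that by auto
  then show ?thesis by (simp add: env_def)
qed

lemma env_run:
  assumes "env s" "writes c \<inter> constants = {}" "puts c \<inter> {Values, Counts} = {}"
  shows "env (run c s)"
proof -
  have "x \<notin> writes c" if "x \<in> constants" for x using assms(2) that by blast
  moreover have "Values \<notin> puts c" "Counts \<notin> puts c" using assms(3) by blast+
  ultimately show ?thesis
    using assms(1) unfolding env_def constants_def by (simp add: run_Var run_Elem)
qed

lemma env_simps [simp]:
  assumes "env s"
  shows "s (Elem Values k) = V k" "s (Elem Counts k) = U k" "s (Var Cands) = m"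
    "s (Var Voters) = n" "s (Var Target) = target" "s (Var Width) = target + target + 1"
    "s (Var Budget) = B" "s (Var Despised) = d" "s (Var Start) = price 0"
  using assms by (simp_all add: env_def)

lemma run_places:
  assumes "env s" "i < n" "c \<in> {1..m}" "s (Var Vote) = m + 3 + i * (m + 1)" "s (Var Cand) = c"
  defines "s' \<equiv> run places s"
  shows "s' (Var PosD) = place i d" "s' (Var PosC) = place i c"
proof -
  \<comment> \<open>A place is claimed only once the scan has passed it; after \<open>m\<close>
    rounds this covers both candidates, by \<open>place_less\<close>.\<close>
  define P where "P j s \<longleftrightarrow> env s \<and> s (Var Vote) = m + 3 + i * (m + 1) \<and> s (Var Cand) = c \<and>
    (place i d < j \<longrightarrow> s (Var PosD) = place i d) \<and> (place i c < j \<longrightarrow> s (Var PosC) = place i c)"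
    for j and s :: state
  have "P m s'"
    unfolding s'_def places_def run.simps(6) env_simps(3)[OF assms(1)]
  proof (rule iter_invariant[where P = P])
    show "P 0 s" using assms by (simp add: P_def)
  next
    fix j u assume j: "j < m" "P j u"
    then have u: "env u" "u (Var Vote) = m + 3 + i * (m + 1)" "u (Var Cand) = c"
      by (simp_all add: P_def)
    define v where "v = run (IfPos (apart (At Values (Get Vote [+] Get Place)) (Get Despised)) Skip
          (PosD ::= Get Place) ;;
        IfPos (apart (At Values (Get Vote [+] Get Place)) (Get Cand)) Skip
          (PosC ::= Get Place)) (u(Var Place := j))"
    have V: "V (m + 3 + i * (m + 1) + j) = d \<longleftrightarrow> j = place i d"
        "V (m + 3 + i * (m + 1) + j) = c \<longleftrightarrow> j = place i c"
      using place[OF assms(2) d j(1)] place[OF assms(2,3) j(1)] by blast+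
    have apart: "0 < (x - y) + (y - x) \<longleftrightarrow> x \<noteq> y" for x y :: nat by auto
    have "run (IfPos (apart (At Values (Get Vote [+] Get Place)) (Get Despised)) Skip
          (PosD ::= Get Place)) (u(Var Place := j)) =
        (if j = place i d then u(Var Place := j, Var PosD := j) else u(Var Place := j))"
      using u V(1) by (simp only: run.simps eval.simps apart) (simp add: constants_def)
    then have "v = (if j = place i d
        then if j = place i c then u(Var Place := j, Var PosD := j, Var PosC := j)
          else u(Var Place := j, Var PosD := j)
        else if j = place i c then u(Var Place := j, Var PosC := j) else u(Var Place := j))"
      unfolding v_def run.simps(4) using u V(2)
      by (cases "j = place i d") (simp_all only: run.simps eval.simps apart, simp_all add: constants_def)
    then show "P (Suc j) v"
      using j(2) by (simp add: P_def constants_def less_Suc_eq)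
  qed
  then show "s' (Var PosD) = place i d" "s' (Var PosC) = place i c"
    using place_less[OF assms(2) d] place_less[OF assms(2,3)] by (simp_all add: P_def)
qed

lemma run_gains:
  assumes "env s" "t < m"
  shows "run gains s (Elem Gain t) = gain (s (Var PosD)) (s (Var PosC)) t"
proof -
  define pd pc where "pd = s (Var PosD)" "pc = s (Var PosC)"
  define P where "P j s \<longleftrightarrow> env s \<and> s (Var PosD) = pd \<and> s (Var PosC) = pc \<and>
    (\<forall>t<j. s (Elem Gain t) = gain pd pc t)" for j and s :: state
  have "P m (run gains s)"
    unfolding gains_def run.simps(6) env_simps(3)[OF assms(1)]
  proof (rule iter_invariant[where P = P])
    show "P 0 s" using assms by (simp add: P_def pd_pc_def)
  next
    fix j u assume "j < m" "P j u"
    then have u: "env u" "u (Var PosD) = pd" "u (Var PosC) = pc" "\<forall>t<j. u (Elem Gain t) = gain pd pc t"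
      by (simp_all add: P_def)
    define v where "v = run (Acc ::= Get PosC ;;
        IfPos (Get PosC [-] Get PosD)
          (IfPos (Get PosD [+] Get Shift [+] Num 1 [-] Get PosC) (Acc ::= Get PosC [-] Num 1) Skip)
          Skip ;;
        Put Gain (Get Shift)
          (At Counts (Num 1 [+] Get Acc) [+] At Counts (Num 1) [-]
             At Counts (Num 1 [+] (Get PosD [+] Get Shift)))) (u(Var Shift := j))"
    have "v = u(Var Shift := j, Var Acc := (if pd < pc \<and> pc \<le> pd + j then pc - 1 else pc),
        Elem Gain j := gain pd pc j)"
      by (cases "pd < pc"; cases "pc \<le> pd + j") (use u in \<open>simp_all add: v_def gain_def constants_def\<close>)
    then show "P (Suc j) v"
      using u by (simp add: P_def constants_def less_Suc_eq)
  qed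
  then show ?thesis using assms(2) by (auto simp: P_def pd_pc_def)
qed

text \<open>A minimum is at most \<open>b\<close> iff one of the compared values is, and the cap
  \<open>B + 1\<close> exceeds every admissible \<open>b\<close>; comparisons thus describe the
  entry without naming the minimum. The loop tries all \<open>m\<close> shifts because its limit
  must be a fixed variable, and the test against the length \<open>V q\<close> of the price list
  drops those of infinite price.\<close>

lemma run_relax:
  assumes "env s" "k < target + target + 1" "b \<le> B" "s (Var Price) = q" "V q \<le> m"
  shows "run relax s (Elem Next k) \<le> b \<longleftrightarrow>
    (\<exists>t < V q. s (Elem Gain t) \<le> k \<and>
       s (Elem Best (k - s (Elem Gain t))) + V (q + 1 + t) \<le> b)"
proof -
  define ok where "ok l k b \<longleftrightarrow> (\<exists>t < V q. t < l \<and> s (Elem Gain t) \<le> k \<and>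
       s (Elem Best (k - s (Elem Gain t))) + V (q + 1 + t) \<le> b)" for l k b
  have ok_Suc: "ok (Suc l) k b \<longleftrightarrow> ok l k b \<or> l < V q \<and> s (Elem Gain l) \<le> k \<and>
       s (Elem Best (k - s (Elem Gain l))) + V (q + 1 + l) \<le> b" for l k b
    unfolding ok_def less_Suc_eq by blast
  define inner where "inner =
    IfPos (At Values (Get Price) [-] Get Shift)
             (IfPos (Get Total [+] Num 1 [-] At Gain (Get Shift))
                (IfPos (Get Acc [-] (At Best (Get Total [-] At Gain (Get Shift)) [+]
                    At Values (Get Price [+] Num 1 [+] Get Shift)))
                   (Acc ::= At Best (Get Total [-] At Gain (Get Shift)) [+]
                      At Values (Get Price [+] Num 1 [+] Get Shift))
                   Skip)
                Skip)
             Skip"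
  define P where "P j u \<longleftrightarrow> env u \<and> u (Var Price) = q \<and> (\<forall>t. u (Elem Gain t) = s (Elem Gain t)) \<and>
    (\<forall>k. u (Elem Best k) = s (Elem Best k)) \<and> (\<forall>k<j. \<forall>b\<le>B. u (Elem Next k) \<le> b \<longleftrightarrow> ok m k b)"
    for j and u :: state
  \<comment> \<open>Before the first shift is tried, \<open>Acc\<close> is \<open>B + 1\<close> and
    \<open>ok 0 j b\<close> fails, so both sides of the equivalence are false.\<close>
  define Q where "Q j l u \<longleftrightarrow> P j u \<and> u (Var Total) = j \<and> u (Var Acc) \<le> B + 1 \<and>
    (\<forall>b\<le>B. u (Var Acc) \<le> b \<longleftrightarrow> ok l j b)" for j l and u :: state
  have P_upd: "P j (u(Var x := v)) \<longleftrightarrow> P j u" if "x \<notin> constants" "x \<noteq> Price" for j u x v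
    using that by (simp add: P_def)
  have inner: "Q j m (run (For Shift Cands inner) u)" if Q: "Q j 0 u" for j u
  proof -
    have "u (Var Cands) = m" using Q by (simp add: Q_def P_def)
    show ?thesis unfolding run.simps(6) \<open>u (Var Cands) = m\<close>
    proof (rule iter_invariant[where P = "Q j"])
      fix l u assume l: "l < m" and "Q j l u"
      then have u: "P j u" "u (Var Total) = j" "u (Var Acc) \<le> B + 1"
        "\<And>b. b \<le> B \<Longrightarrow> u (Var Acc) \<le> b \<longleftrightarrow> ok l j b" by (auto simp: Q_def)
      from u(1) have e: "env u" "u (Var Price) = q" "u (Elem Gain t) = s (Elem Gain t)"
        "u (Elem Best k) = s (Elem Best k)" for k t by (auto simp: P_def)
      let ?x = "s (Elem Best (j - s (Elem Gain l))) + V (q + 1 + l)"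
      define u' where "u' = run inner (u(Var Shift := l))"
      have u': "u' = (if l < V q \<and> s (Elem Gain l) \<le> j \<and> ?x < u (Var Acc)
          then u(Var Shift := l, Var Acc := ?x) else u(Var Shift := l))"
        using u(2) e
        by (cases "l < V q"; cases "s (Elem Gain l) \<le> j"; cases "?x < u (Var Acc)")
          (simp_all add: u'_def inner_def constants_def)
      have "P j u'" "u' (Var Total) = j" using u(1,2) by (simp_all add: u' P_upd constants_def)
      moreover have "u' (Var Acc) \<le> B + 1" using u(3) by (simp add: u')
      moreover have "u' (Var Acc) \<le> b \<longleftrightarrow> ok (Suc l) j b" if "b \<le> B" for b
        using u(4)[OF that] by (auto simp: u' ok_Suc)
      ultimately show "Q j (Suc l) (run inner (u(Var Shift := l)))" unfolding Q_def u'_def by blast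
    qed (rule Q)
  qed
  have "P (target + target + 1) (run relax s)"
    unfolding relax_def inner_def[symmetric] run.simps(6)[of Total] env_simps(6)[OF assms(1)]
  proof (rule iter_invariant[where P = P])
    show "P 0 s" using assms by (simp add: P_def)
  next
    fix j u assume Suc: "j < target + target + 1" "P j u"
    have "Q j 0 (u(Var Total := j, Var Acc := B + 1))"
      using Suc(2) by (auto simp: Q_def P_upd constants_def ok_def)
    from inner[OF this] have Q: "Q j m (run (For Shift Cands inner) (u(Var Total := j, Var Acc := B + 1)))" .
    moreover have "env u" using Suc(2) by (simp add: P_def)
    ultimately show "P (Suc j) (run (Acc ::= Get Budget [+] Num 1 ;; For Shift Cands inner ;;
        Put Next (Get Total) (Get Acc)) (u(Var Total := j)))"
      by (auto simp: Q_def P_def constants_def less_Suc_eq simp del: run.simps(6))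
  qed
  then have "run relax s (Elem Next k) \<le> b \<longleftrightarrow> ok m k b"
    using assms by (simp add: P_def)
  then show ?thesis using assms(5) by (auto simp: ok_def)
qed

lemma run_copy:
  assumes "env s" "k < target + target + 1"
  shows "run copy s (Elem Best k) = s (Elem Next k)"
proof -
  define P where "P j u \<longleftrightarrow> (\<forall>k. u (Elem Next k) = s (Elem Next k)) \<and>
    (\<forall>k<j. u (Elem Best k) = s (Elem Next k))" for j and u :: state
  have "P (target + target + 1) (run copy s)"
    unfolding copy_def run.simps(6) env_simps(6)[OF assms(1)]
    by (rule iter_invariant[where P = P]) (auto simp: P_def less_Suc_eq)
  then show ?thesis using assms(2) by (simp add: P_def)
qed

text \<open>The row after \<open>i\<close> voters. Entries are fixed only through comparisons with
  bounds up to \<open>B\<close>, so the value that marks an unreachable or too expensive total stays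
  open.\<close>

definition table :: "nat \<Rightarrow> nat \<Rightarrow> state \<Rightarrow> bool" where
  "table c i s \<longleftrightarrow> env s \<and> s (Var Cand) = c \<and> s (Var Vote) = m + 3 + i * (m + 1) \<and>
     s (Var Price) = price i \<and>
     (\<forall>k < target + target + 1. \<forall>b \<le> B. s (Elem Best k) \<le> b \<longleftrightarrow> reachable c i k b)"

lemma run_voter:
  assumes "table c i s" "i < n" "c \<in> {1..m}"
  shows "table c (Suc i) (run voter s)"
proof -
  have s: "env s" "s (Var Cand) = c" "s (Var Vote) = m + 3 + i * (m + 1)" "s (Var Price) = price i"
    using assms(1) by (auto simp: table_def)
  define s1 where "s1 = run places s"
  define s2 where "s2 = run gains s1"
  define s3 where "s3 = run relax s2"
  define s4 where "s4 = run copy s3"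
  have env: "env s1" "env s2" "env s3" "env s4"
    unfolding s4_def s3_def s2_def s1_def using s(1)
    by (auto intro!: env_run simp: constants_def)
  have fr: "s4 (Var x) = s (Var x)" "s2 (Var x) = s (Var x)" if "x \<in> {Cand, Vote, Price}" for x
    unfolding s4_def s3_def s2_def s1_def using that
    by (auto simp: run_Var simp del: run.simps)
  have "s1 (Var PosD) = place i d" "s1 (Var PosC) = place i c"
    unfolding s1_def using run_places[OF s(1) assms(2,3) s(3,2)] by auto
  then have gain: "s2 (Elem Gain t) = gain (place i d) (place i c) t" if "t < m" for t
    unfolding s2_def using run_gains[OF env(1) that] by simp
  have best: "s2 (Elem Best k) = s (Elem Best k)" for k
    unfolding s2_def s1_def by (auto simp: run_Elem simp del: run.simps)
  have best_s: "s (Elem Best x) \<le> y \<longleftrightarrow> reachable c i x y"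
    if "x < target + target + 1" "y \<le> B" for x y
    using assms(1) that by (simp add: table_def)
  have "s4 (Elem Best k) \<le> b \<longleftrightarrow> reachable c (Suc i) k b"
    if k: "k < target + target + 1" and b: "b \<le> B" for k b
  proof -
    have bounds: "k - x < target + target + 1" "b - x \<le> B" for x using k b by simp_all
    have "s4 (Elem Best k) \<le> b \<longleftrightarrow> s3 (Elem Next k) \<le> b"
      unfolding s4_def using run_copy[OF env(3) k] by simp
    also have "\<dots> \<longleftrightarrow> (\<exists>t < V (price i). s2 (Elem Gain t) \<le> k \<and>
        s2 (Elem Best (k - s2 (Elem Gain t))) + V (price i + 1 + t) \<le> b)"
      unfolding s3_def using fr(2)[of Price] s(4) prices_le[OF assms(2)]
      by (intro run_relax env k b) simp_all
    \<comment> \<open>\<open>x + p \<le> b\<close> is split into \<open>p \<le> b\<close> and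
      \<open>x \<le> b - p\<close>, the form used in the recursion of \<open>reach\<close>.\<close>
    also have "\<dots> \<longleftrightarrow> (\<exists>t < V (price i). gain (place i d) (place i c) t \<le> k \<and>
        V (price i + 1 + t) \<le> b \<and>
        s (Elem Best (k - gain (place i d) (place i c) t)) \<le> b - V (price i + 1 + t))"
      using prices_le[OF assms(2)] by (intro ex_cong1) (auto simp: gain best)
    also have "\<dots> \<longleftrightarrow> (\<exists>t < V (price i). gain (place i d) (place i c) t \<le> k \<and>
        V (price i + 1 + t) \<le> b \<and>
        reachable c i (k - gain (place i d) (place i c) t) (b - V (price i + 1 + t)))"
      by (simp only: best_s[OF bounds])
    also have "\<dots> \<longleftrightarrow> reachable c (Suc i) k b" by (simp add: reachable_def)
    finally show ?thesis .
  qed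
  moreover have "run voter s = s4(Var Vote := s4 (Var Vote) + m + 1,
      Var Price := s4 (Var Price) + V (s4 (Var Price)) + 1)"
    using env(4) by (simp add: voter_def s4_def s3_def s2_def s1_def)
  ultimately show ?thesis
    using env(4) fr(1)[of Cand] fr(1)[of Vote] fr(1)[of Price] s price[OF assms(2)]
    by (simp add: table_def constants_def)
qed

lemma run_challenge:
  assumes "env s" "s (Var Cand) = c" "c \<in> {1..m}"
  shows "run challenge s (Var Ans) > 0 \<longleftrightarrow> s (Var Ans) > 0 \<or>
    (\<exists>k < target + target + 1. target \<le> k \<and> reachable c n k B)"
proof -
  let ?W = "target + target + 1"
  define s1 where "s1 = run (For Total Width (Put Best (Get Total) (Get Budget [+] Num 1))) s"
  have env1: "env s1" "s1 (Var Cand) = c" "s1 (Var Ans) = s (Var Ans)"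
    unfolding s1_def using assms
    by (auto intro!: env_run simp: run_Var constants_def simp del: run.simps)
  define P where "P j u \<longleftrightarrow> env u \<and> (\<forall>k<j. u (Elem Best k) = B + 1)" for j and u :: state
  have "P ?W s1"
    unfolding s1_def run.simps(6) env_simps(6)[OF assms(1)]
    by (rule iter_invariant[where P = P]) (use assms in \<open>auto simp: P_def less_Suc_eq constants_def\<close>)
  then have s1: "s1 (Elem Best k) = B + 1" if "k < ?W" for k using that by (simp add: P_def)
  define s2 where "s2 = s1(Elem Best 0 := 0, Var Vote := m + 3, Var Price := price 0)"
  \<comment> \<open>Without voters only total 0 is reachable, at cost 0; all other entries are
    \<open>B + 1\<close>, above each admissible \<open>b\<close>.\<close>
  have "s2 (Elem Best k) \<le> b \<longleftrightarrow> reachable c 0 k b" if "k < ?W" "b \<le> B" for k b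
    using s1[OF that(1)] that(2) by (simp add: s2_def reachable_def)
  then have "table c 0 s2"
    using env1 unfolding table_def by (simp add: s2_def constants_def)
  define s3 where "s3 = run (For Voter Voters voter) s2"
  have "s2 (Var Voters) = n" using \<open>table c 0 s2\<close> by (simp add: table_def)
  have "table c n s3"
    unfolding s3_def run.simps(6) \<open>s2 (Var Voters) = n\<close>
  proof (rule iter_invariant[where P = "table c"])
    fix i u assume i: "i < n" and "table c i u"
    then have "table c i (u(Var Voter := i))" by (simp add: table_def constants_def)
    from run_voter[OF this i assms(3)] show "table c (Suc i) (run voter (u(Var Voter := i)))" .
  qed fact
  then have "env s3" by (simp add: table_def)
  from \<open>table c n s3\<close> have s3: "s3 (Elem Best k) \<le> B \<longleftrightarrow> reachable c n k B" if "k < ?W" for k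
    using that by (simp add: table_def)
  have "s3 (Var Ans) = s2 (Var Ans)"
    unfolding s3_def by (auto simp: run_Var simp del: run.simps)
  also have "\<dots> = s (Var Ans)" by (simp add: s2_def env1)
  finally have ans: "s3 (Var Ans) = s (Var Ans)" .
  define last where "last = For Total Width
       (IfPos (Get Total [+] Num 1 [-] Get Target)
          (IfPos (Get Budget [+] Num 1 [-] At Best (Get Total)) (Ans ::= Num 1) Skip)
          Skip)"
  define Q where "Q j u \<longleftrightarrow> env u \<and> (\<forall>k. u (Elem Best k) = s3 (Elem Best k)) \<and>
    (u (Var Ans) > 0 \<longleftrightarrow> s (Var Ans) > 0 \<or> (\<exists>k<j. target \<le> k \<and> s3 (Elem Best k) \<le> B))"
    for j and u :: state
  have "Q ?W (run last s3)"
    unfolding last_def run.simps(6) env_simps(6)[OF \<open>env s3\<close>]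
  proof (rule iter_invariant[where P = Q])
    show "Q 0 s3" using \<open>env s3\<close> ans by (simp add: Q_def)
  next
    fix j u assume "j < ?W" "Q j u"
    then have u: "env u" "\<forall>k. u (Elem Best k) = s3 (Elem Best k)"
      "u (Var Ans) > 0 \<longleftrightarrow> s (Var Ans) > 0 \<or> (\<exists>k<j. target \<le> k \<and> s3 (Elem Best k) \<le> B)"
      by (simp_all add: Q_def)
    have ex: "(\<exists>k<Suc j. R k) \<longleftrightarrow> (\<exists>k<j. R k) \<or> R j" for R by (auto simp: less_Suc_eq)
    define v where "v = run (IfPos (Get Total [+] Num 1 [-] Get Target)
          (IfPos (Get Budget [+] Num 1 [-] At Best (Get Total)) (Ans ::= Num 1) Skip)
          Skip) (u(Var Total := j))"
    have "v = (if target \<le> j \<and> s3 (Elem Best j) \<le> B then u(Var Total := j, Var Ans := 1)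
        else u(Var Total := j))"
      using u(1,2) by (cases "target \<le> j"; cases "s3 (Elem Best j) \<le> B")
        (simp_all add: v_def constants_def)
    then show "Q (Suc j) v"
      using u unfolding Q_def ex
      by (cases "target \<le> j \<and> s3 (Elem Best j) \<le> B") (simp_all add: constants_def, blast)
  qed
  moreover have "run challenge s = run last s3"
    using env1 by (simp add: challenge_def last_def s3_def s2_def s1_def del: run.simps(6))
  ultimately show ?thesis using s3 by (auto simp: Q_def)
qed

theorem run_search:
  assumes "env s" "s (Var Ans) = 0"
  shows "run search s (Var Ans) > 0 \<longleftrightarrow>
    (\<exists>c\<in>{1..m}. c \<noteq> d \<and> (\<exists>k < target + target + 1. target \<le> k \<and> reachable c n k B))"
proof -
  define P where "P j u \<longleftrightarrow> env u \<and> (u (Var Ans) > 0 \<longleftrightarrow>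
    (\<exists>c\<in>{1..j}. c \<noteq> d \<and> (\<exists>k < target + target + 1. target \<le> k \<and> reachable c n k B)))"
    for j and u :: state
  have "P m (run search s)"
    unfolding search_def run.simps(6) env_simps(3)[OF assms(1)]
  proof (rule iter_invariant[where P = P])
    show "P 0 s" using assms by (simp add: P_def)
  next
    fix j u assume Suc: "j < m" "P j u"
    define v where "v = u(Var Number := j, Var Cand := Suc j)"
    have u: "u (Var Despised) = d" using Suc(2) by (simp add: P_def)
    have v: "env v" "v (Var Cand) = Suc j" "v (Var Ans) = u (Var Ans)"
      using Suc(2) by (simp_all add: v_def P_def constants_def)
    have env: "env (run challenge v)"
      using v(1) by (intro env_run) (auto simp: constants_def)
    have run: "run (Cand ::= Get Number [+] Num 1 ;;
        IfPos (apart (Get Cand) (Get Despised)) challenge Skip) (u(Var Number := j)) =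
      (if Suc j = d then v else run challenge v)"
      using u by (cases "Suc j" d rule: linorder_cases) (simp_all add: v_def)
    show "P (Suc j) (run (Cand ::= Get Number [+] Num 1 ;;
        IfPos (apart (Get Cand) (Get Despised)) challenge Skip) (u(Var Number := j)))"
      unfolding run P_def
      using run_challenge[OF v(1,2)] Suc v env by (auto simp: P_def atLeastAtMostSuc_conv)
  qed
  then show ?thesis by (simp add: P_def)
qed

end

section \<open>Shifting the despised candidate\<close>

definition place :: "'c vote \<Rightarrow> 'c \<Rightarrow> nat" where
  "place v c = pos v c - 1"

lemma place_nth:
  assumes "c \<in> set v"
  shows "place v c < length v" "v ! place v c = c"
proof -
  have *: "place v c = length (takeWhile (\<lambda>x. x \<noteq> c) v)" by (simp add: place_def pos_def)
  have "dropWhile (\<lambda>x. x \<noteq> c) v \<noteq> []" using assms by (auto simp: dropWhile_eq_Nil_conv)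
  moreover have "length v = place v c + length (dropWhile (\<lambda>x. x \<noteq> c) v)"
    unfolding * length_append[symmetric] takeWhile_dropWhile_id ..
  ultimately show "place v c < length v" by simp
  then show "v ! place v c = c"
    using nth_length_takeWhile[of "\<lambda>x. x \<noteq> c" v] unfolding * by simp
qed

lemma place_eq_iff:
  assumes "distinct v" "k < length v"
  shows "v ! k = c \<longleftrightarrow> c \<in> set v \<and> k = place v c"
  using assms place_nth[of c v] by (metis nth_eq_iff_index_eq nth_mem)

lemma remove1_nth:
  assumes "distinct v" "d \<in> set v" "k < length v - 1"
  shows "remove1 d v ! k = (if k < place v d then v ! k else v ! Suc k)"
proof -
  have j: "place v d < length v" "v ! place v d = d" using place_nth[OF assms(2)] .
  define xs ys where "xs = take (place v d) v" "ys = drop (Suc (place v d)) v"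
  have v: "v = xs @ d # ys" and l: "length xs = place v d"
    unfolding xs_ys_def using id_take_nth_drop[OF j(1)] j by simp_all
  have "d \<notin> set xs" using assms(1) by (subst (asm) v) simp
  then have "remove1 d v = xs @ ys" by (subst v) (simp add: remove1_append)
  moreover have "(xs @ ys) ! k = (if k < length xs then v ! k else v ! Suc k)"
    by (subst v, subst v) (auto simp: nth_append Suc_diff_le not_less)
  ultimately show ?thesis using l by simp
qed

text \<open>Removing \<open>d\<close> moves everything behind it up by one, and reinserting it at
  index \<open>place v d + t\<close> moves everything from there on down again; only the overtaken
  candidates keep a net change. The entries are computed first, and distinctness turns them into
  places.\<close>

lemma place_shift_back:
  assumes "distinct v" "d \<in> set v" "place v d + t < length v"
  shows "place (shift_back d t v) d = place v d + t"
    and "c \<in> set v \<Longrightarrow> c \<noteq> d \<Longrightarrow> place (shift_back d t v) c =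
      (if place v d < place v c \<and> place v c \<le> place v d + t then place v c - 1 else place v c)"
proof -
  define r where "r = remove1 d v"
  let ?j = "place v d"
  let ?w = "shift_back d t v"
  have w: "?w = take (?j + t) r @ d # drop (?j + t) r"
    by (simp add: shift_back_def place_def r_def Let_def)
  have r: "length r = length v - 1" "d \<notin> set r" "distinct r"
    using assms by (simp_all add: r_def length_remove1)
  have len: "length ?w = length v" using r(1) assms(3) unfolding w by simp
  have dist: "distinct ?w"
    unfolding w using r(2,3) set_take_disj_set_drop_if_distinct[OF r(3), of "?j + t" "?j + t"]
    by (auto dest: in_set_takeD in_set_dropD)
  have nth: "?w ! k = (if k < ?j + t then r ! k else if k = ?j + t then d else r ! (k - 1))"
    if "k < length v" for k
    unfolding w using that r(1) assms(3) by (auto simp: nth_append nth_Cons')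
  have rn: "r ! k = (if k < ?j then v ! k else v ! Suc k)" if "k < length v - 1" for k
    unfolding r_def using remove1_nth[OF assms(1,2) that] .
  show "place ?w d = ?j + t"
    using place_eq_iff[OF dist, of "?j + t" d] nth[OF assms(3)] assms(3) len by simp
  assume c: "c \<in> set v" "c \<noteq> d"
  define i where "i = (if ?j < place v c \<and> place v c \<le> ?j + t then place v c - 1 else place v c)"
  have pc: "place v c < length v" "v ! place v c = c" using place_nth[OF c(1)] .
  have ne: "place v c \<noteq> ?j" using pc(2) place_nth(2)[OF assms(2)] c(2) by auto
  have i: "i < length v" using pc(1) by (auto simp: i_def)
  have "?w ! i = c"
  proof (cases "place v c < ?j")
    case True
    then have "i = place v c" "i < length v - 1" using place_nth(1)[OF assms(2)] by (simp_all add: i_def)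
    then show ?thesis using True nth[OF i] rn[of i] pc(2) by simp
  next
    case False
    with ne have gt: "?j < place v c" by simp
    show ?thesis
    proof (cases "place v c \<le> ?j + t")
      case True
      then have "i = place v c - 1" using gt by (simp add: i_def)
      moreover from this have "i < length v - 1" "Suc i = place v c" "\<not> i < ?j" "i < ?j + t"
        using True gt pc(1) by auto
      ultimately show ?thesis using nth[OF i] rn[of i] pc(2) by simp
    next
      case False
      then have "i = place v c" by (simp add: i_def)
      moreover from this have "i - 1 < length v - 1" "Suc (i - 1) = place v c" "\<not> i - 1 < ?j"
          "\<not> i < ?j + t" "i \<noteq> ?j + t"
        using False gt pc(1) by auto
      ultimately show ?thesis using nth[OF i] rn[of "i - 1"] pc(2) by simp
    qed
  qed
  then show "place ?w c = i" using place_eq_iff[OF dist, of i c] i len by simp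
qed

text \<open>If \<open>d\<close> won alone, a rival with at least the score of \<open>d\<close> would
  be a winner as well; if \<open>d\<close> is strictly ahead of everyone else, it is the only
  winner.\<close>

lemma scoring_rule_neq_iff:
  assumes "d \<in> C"
  shows "scoring_rule \<alpha> C V \<noteq> {d} \<longleftrightarrow> (\<exists>c\<in>C. c \<noteq> d \<and> score \<alpha> V d \<le> score \<alpha> V c)"
proof
  assume ne: "scoring_rule \<alpha> C V \<noteq> {d}"
  show "\<exists>c\<in>C. c \<noteq> d \<and> score \<alpha> V d \<le> score \<alpha> V c"
  proof (rule ccontr)
    assume "\<not> ?thesis"
    then have less: "score \<alpha> V c < score \<alpha> V d" if "c \<in> C" "c \<noteq> d" for c
      using that by force
    then have "score \<alpha> V c \<le> score \<alpha> V d" if "c \<in> C" for c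
      using that by (cases "c = d") (auto intro: less_imp_le)
    with less have "scoring_rule \<alpha> C V = {d}"
      using assms unfolding scoring_rule_def by (auto simp: not_le[symmetric])
    with ne show False ..
  qed
next
  assume "\<exists>c\<in>C. c \<noteq> d \<and> score \<alpha> V d \<le> score \<alpha> V c"
  then obtain c where c: "c \<in> C" "c \<noteq> d" "score \<alpha> V d \<le> score \<alpha> V c" by blast
  show "scoring_rule \<alpha> C V \<noteq> {d}"
  proof
    assume "scoring_rule \<alpha> C V = {d}"
    then have "\<forall>c'\<in>C. score \<alpha> V c' \<le> score \<alpha> V d" by (auto simp: scoring_rule_def)
    then have "c \<in> scoring_rule \<alpha> C V" using c by (auto simp: scoring_rule_def intro: le_trans)
    with \<open>scoring_rule \<alpha> C V = {d}\<close> c(2) show False by simp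
  qed
qed

text \<open>By monotonicity the arguments of finite price form an initial segment, so the index in
  the list is the shift itself. \<open>N\<close> is the first argument of infinite price.\<close>

lemma finite_prices:
  assumes "price_function m j \<rho>"
  shows "length (finite_prices \<rho>) \<le> m - j + 1"
    and "\<rho> t = (if t < length (finite_prices \<rho>) then enat (finite_prices \<rho> ! t) else \<infinity>)"
proof -
  let ?S = "{i. \<rho> i \<noteq> \<infinity>}"
  have sub: "?S \<subseteq> {..m - j}" using assms by (force simp: price_function_def not_le[symmetric])
  have down: "i \<in> ?S" if "i < k" "k \<in> ?S" for i k
  proof -
    have "\<rho> i \<le> \<rho> k" using assms that sub by (auto simp: price_function_def)
    then show ?thesis using that by (cases "\<rho> i") auto
  qed
  define N where "N = (LEAST i. i \<notin> ?S)"
  have "Suc (m - j) \<notin> ?S" using sub by auto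
  then have N: "N \<notin> ?S" "N \<le> Suc (m - j)"
    unfolding N_def by (rule LeastI, intro Least_le)
  have S: "?S = {..<N}"
  proof (intro set_eqI iffI)
    fix i assume "i \<in> ?S"
    with down[of N i] N(1) show "i \<in> {..<N}" by (cases i N rule: linorder_cases) auto
  next
    fix i assume "i \<in> {..<N}"
    then show "i \<in> ?S" using not_less_Least[of i "\<lambda>i. i \<notin> ?S"] by (auto simp: N_def)
  qed
  have "sorted_list_of_set ?S = [0..<N]"
    unfolding S by (simp add: atLeast0LessThan[symmetric])
  then have fp: "finite_prices \<rho> = map (\<lambda>i. the_enat (\<rho> i)) [0..<N]"
    by (simp add: finite_prices_def)
  then show "length (finite_prices \<rho>) \<le> m - j + 1" using N(2) by simp
  have "\<rho> t \<noteq> \<infinity> \<longleftrightarrow> t < N" using S by auto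
  then show "\<rho> t = (if t < length (finite_prices \<rho>) then enat (finite_prices \<rho> ! t) else \<infinity>)"
    by (cases "\<rho> t") (auto simp: fp)
qed

lemma sum_enat: "(\<Sum>i\<in>A. enat (f i)) = enat (\<Sum>i\<in>A. f i)"
  by (induction A rule: infinite_finite_induct) (simp_all add: zero_enat_def)

text \<open>A single infinite price exceeds every budget, so an affordable choice uses listed prices
  only, and the sum may be taken over natural numbers.\<close>

lemma sum_prices_le_iff:
  fixes n :: nat
  assumes "\<And>i. i < n \<Longrightarrow> price_function m (j i) (\<rho> i)"
  shows "(\<Sum>i<n. \<rho> i (t i)) \<le> enat b \<longleftrightarrow>
    (\<forall>i<n. t i < length (finite_prices (\<rho> i))) \<and>
    (\<Sum>i<n. finite_prices (\<rho> i) ! t i) \<le> b"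
proof (cases "\<forall>i<n. t i < length (finite_prices (\<rho> i))")
  case True
  have "\<rho> i (t i) = enat (finite_prices (\<rho> i) ! t i)" if "i < n" for i
    using finite_prices(2)[OF assms[OF that], of "t i"] True that by simp
  then have "(\<Sum>i<n. \<rho> i (t i)) = (\<Sum>i<n. enat (finite_prices (\<rho> i) ! t i))"
    by (intro sum.cong) auto
  with True show ?thesis by (simp add: sum_enat)
next
  case False
  then obtain i where i: "i < n" "\<not> t i < length (finite_prices (\<rho> i))" by blast
  then have "\<rho> i (t i) = \<infinity>" using finite_prices(2)[OF assms[OF i(1)]] by simp
  moreover have "\<rho> i (t i) \<le> (\<Sum>i<n. \<rho> i (t i))" using i(1) by (intro member_le_sum) auto
  ultimately show ?thesis using False by auto
qed

text \<open>Each gain is raised by the largest entry of the protocol, which makes it a natural number.\<close>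

definition shift_gain :: "nat list \<Rightarrow> 'c vote \<Rightarrow> 'c \<Rightarrow> 'c \<Rightarrow> nat \<Rightarrow> nat" where
  "shift_gain \<alpha> v d c t =
     \<alpha> ! (if place v d < place v c \<and> place v c \<le> place v d + t then place v c - 1 else place v c) +
     \<alpha> ! 0 - \<alpha> ! (place v d + t)"

text \<open>In each vote the gain is the new entry of \<open>c\<close> minus that of
  \<open>d\<close>, plus the top entry. Summed over the \<open>n\<close> votes, \<open>c\<close>
  catches up with \<open>d\<close> iff the total gain is at least \<open>n\<close> times the top
  entry.\<close>

lemma destructive_shift_bribery_iff:
  assumes I: "bribery_instance I" and \<alpha>: "scoring_protocol (card (cands I)) \<alpha>"
  defines "n \<equiv> length (votes I)" and "d \<equiv> despised I"
  shows "destructive_shift_bribery (scoring_rule \<alpha>) I \<longleftrightarrow>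
    (\<exists>c\<in>cands I. c \<noteq> d \<and> (\<exists>t. (\<forall>i<n. t i < length (finite_prices (prices I ! i))) \<and>
       (\<Sum>i<n. finite_prices (prices I ! i) ! t i) \<le> budget I \<and>
       n * \<alpha> ! 0 \<le> (\<Sum>i<n. shift_gain \<alpha> (votes I ! i) d c (t i))))"
proof -
  let ?m = "card (cands I)"
  have d: "d \<in> cands I" using I by (simp add: bribery_instance_def d_def)
  have vote: "distinct (votes I ! i)" "set (votes I ! i) = cands I" "length (votes I ! i) = ?m"
    if "i < n" for i
  proof -
    have "votes I ! i \<in> set (votes I)" using that by (simp add: n_def)
    then show *: "distinct (votes I ! i)" "set (votes I ! i) = cands I"
      using I by (auto simp: bribery_instance_def election_def)
    show "length (votes I ! i) = ?m" using distinct_card[OF *(1)] *(2) by simp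
  qed
  have pf: "price_function ?m (pos (votes I ! i) d) (prices I ! i)" if "i < n" for i
    using I that by (simp add: bribery_instance_def n_def d_def)
  have score: "n * \<alpha> ! 0 \<le> (\<Sum>i<n. shift_gain \<alpha> (votes I ! i) d c (t i)) \<longleftrightarrow>
      score \<alpha> (map2 (shift_back d) ts (votes I)) d \<le> score \<alpha> (map2 (shift_back d) ts (votes I)) c"
    if t: "\<And>i. i < n \<Longrightarrow> t i < length (finite_prices (prices I ! i))"
      "length ts = n" "\<And>i. i < n \<Longrightarrow> ts ! i = t i" and c: "c \<in> cands I" "c \<noteq> d" for t ts c
  proof -
    let ?w = "\<lambda>i. shift_back d (t i) (votes I ! i)"
    let ?x = "\<lambda>i. \<alpha> ! place (?w i) d" and ?y = "\<lambda>i. \<alpha> ! place (?w i) c"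
    have sc: "score \<alpha> (map2 (shift_back d) ts (votes I)) e = (\<Sum>i<n. \<alpha> ! place (?w i) e)" for e
      using t(2,3) by (simp add: score_def place_def sum_list_sum_nth n_def atLeast0LessThan)
    have g: "shift_gain \<alpha> (votes I ! i) d c (t i) + ?x i = ?y i + \<alpha> ! 0" if i: "i < n" for i
    proof -
      have "place (votes I ! i) d < ?m" using place_nth(1)[of d "votes I ! i"] vote[OF i] d by simp
      \<comment> \<open>A finite price means \<open>t \<le> m - pos\<close>, and
        \<open>place\<close> is \<open>pos - 1\<close>; hence the shift keeps \<open>d\<close>
        inside the vote.\<close>
      then have bound: "place (votes I ! i) d + t i < length (votes I ! i)"
        using finite_prices(1)[OF pf[OF i]] t(1)[OF i] vote(3)[OF i]
        by (simp add: place_def pos_def)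
      \<comment> \<open>The protocol is nonincreasing, so the subtraction in
        \<open>shift_gain\<close> is exact.\<close>
      have "\<alpha> ! (place (votes I ! i) d + t i) \<le> \<alpha> ! 0"
        using \<alpha> bound vote(3)[OF i]
        by (cases "place (votes I ! i) d + t i")
          (auto simp: scoring_protocol_def sorted_wrt_iff_nth_less)
      then show ?thesis
        using place_shift_back[OF vote(1)[OF i] _ bound] vote(2)[OF i] d c
        by (simp add: shift_gain_def)
    qed
    have "(\<Sum>i<n. shift_gain \<alpha> (votes I ! i) d c (t i)) + (\<Sum>i<n. ?x i) = (\<Sum>i<n. ?y i) + n * \<alpha> ! 0"
      using sum.cong[OF refl g, of "{..<n}"] by (simp add: sum.distrib)
    then show ?thesis unfolding sc by linarith
  qed
  show ?thesis (is "?l \<longleftrightarrow> ?r")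
  proof
    assume ?l
    then obtain ts where ts: "length ts = n" "(\<Sum>i<n. (prices I ! i) (ts ! i)) \<le> enat (budget I)"
        "scoring_rule \<alpha> (cands I) (map2 (shift_back d) ts (votes I)) \<noteq> {d}"
      unfolding destructive_shift_bribery_def n_def d_def by blast
    then obtain c where c: "c \<in> cands I" "c \<noteq> d" "score \<alpha> (map2 (shift_back d) ts (votes I)) d \<le>
        score \<alpha> (map2 (shift_back d) ts (votes I)) c"
      using scoring_rule_neq_iff[OF d] by blast
    have t: "\<forall>i<n. ts ! i < length (finite_prices (prices I ! i))"
        "(\<Sum>i<n. finite_prices (prices I ! i) ! (ts ! i)) \<le> budget I"
      using ts(2) sum_prices_le_iff[of n ?m "\<lambda>i. pos (votes I ! i) d" "\<lambda>i. prices I ! i", OF pf]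
      by auto
    with c score[of "\<lambda>i. ts ! i" ts c] ts(1) show ?r by blast
  next
    assume ?r
    then obtain c t where c: "c \<in> cands I" "c \<noteq> d"
        and t: "\<forall>i<n. t i < length (finite_prices (prices I ! i))"
        "(\<Sum>i<n. finite_prices (prices I ! i) ! t i) \<le> budget I"
        "n * \<alpha> ! 0 \<le> (\<Sum>i<n. shift_gain \<alpha> (votes I ! i) d c (t i))" by blast
    let ?ts = "map t [0..<n]"
    have "(\<Sum>i<n. (prices I ! i) (?ts ! i)) \<le> enat (budget I)"
      using t sum_prices_le_iff[of n ?m "\<lambda>i. pos (votes I ! i) d" "\<lambda>i. prices I ! i" "\<lambda>i. ?ts ! i", OF pf]
      by simp
    moreover have "scoring_rule \<alpha> (cands I) (map2 (shift_back d) ?ts (votes I)) \<noteq> {d}"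
      using scoring_rule_neq_iff[OF d] score[of t ?ts c] t c by auto
    ultimately show ?l
      unfolding destructive_shift_bribery_def n_def d_def by (intro exI[of _ ?ts]) (simp add: n_def)
  qed
qed

section \<open>The decision procedure\<close>

text \<open>The preparation is split in three because the time bound asks for limits that the
  command itself does not write: \<open>Voters\<close> is set here and limits the loop of the next
  part.\<close>

definition measure_input :: com where
  "measure_input =
     Cands ::= At Values (Num 0) ;;
     Voters ::= At Values (Get Cands [+] Num 1) ;;
     Target ::= Num 0 ;;
     Start ::= Get Cands [+] Num 2"

text \<open>Multiplication by repeated addition: one loop yields both the target and the index of
  the first token behind the votes.\<close>

definition skip_votes :: com where
  "skip_votes =
     For Voter Voters
       (Target ::= Get Target [+] At Counts (Num 1) ;;
        Start ::= Get Start [+] Get Cands [+] Num 1)"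

text \<open>The 3 skips the despised candidate, the budget and the number of price lists.\<close>

definition load_query :: com where
  "load_query =
     Despised ::= At Values (Get Start) ;;
     Budget ::= At Values (Get Start [+] Num 1) ;;
     Start ::= Get Start [+] Num 3 ;;
     Width ::= Get Target [+] Get Target [+] Num 1 ;;
     Ans ::= Num 0"

definition prepare :: com where
  "prepare = measure_input ;; skip_votes ;; load_query"

lemma run_prepare:
  assumes "s (Elem Values 0) = m" "s (Elem Values (m + 1)) = n"
  defines "s' \<equiv> run prepare s" and "u \<equiv> m + 2 + n * (m + 1)"
  shows "s' (Elem a k) = s (Elem a k)" "s' (Var Cands) = m" "s' (Var Voters) = n"
    "s' (Var Target) = n * s (Elem Counts 1)" "s' (Var Start) = u + 3"
    "s' (Var Width) = n * s (Elem Counts 1) + n * s (Elem Counts 1) + 1"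
    "s' (Var Despised) = s (Elem Values u)" "s' (Var Budget) = s (Elem Values (u + 1))"
    "s' (Var Ans) = 0"
proof -
  define P where "P i v \<longleftrightarrow> (\<forall>a k. v (Elem a k) = s (Elem a k)) \<and> v (Var Cands) = m \<and>
    v (Var Voters) = n \<and> v (Var Target) = i * s (Elem Counts 1) \<and>
    v (Var Start) = m + 2 + i * (m + 1)" for i and v :: state
  define s1 where "s1 = run measure_input s"
  have P0: "P 0 s1" using assms(1,2) by (simp add: P_def s1_def measure_input_def)
  then have "s1 (Var Voters) = n" by (simp add: P_def)
  have "P n (run skip_votes s1)"
    unfolding skip_votes_def run.simps(6) \<open>s1 (Var Voters) = n\<close>
    by (rule iter_invariant[where P = P]) (use P0 in \<open>auto simp: P_def\<close>)
  moreover have "s' = run load_query (run skip_votes s1)"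
    by (simp add: s'_def prepare_def s1_def)
  ultimately show "s' (Elem a k) = s (Elem a k)" "s' (Var Cands) = m" "s' (Var Voters) = n"
    "s' (Var Target) = n * s (Elem Counts 1)" "s' (Var Start) = u + 3"
    "s' (Var Width) = n * s (Elem Counts 1) + n * s (Elem Counts 1) + 1"
    "s' (Var Despised) = s (Elem Values u)" "s' (Var Budget) = s (Elem Values (u + 1))"
    "s' (Var Ans) = 0"
    by (simp_all add: load_query_def P_def u_def)
qed

text \<open>Here the unary protocol pays off: its first entry is at most the input length
  \<open>l\<close>, so \<open>Width\<close> is at most \<open>1 + 2 * l * l\<close>. The polynomial
  \<open>[:1, 1, 2:]\<close> bounds this and the two linear limits \<open>Cands\<close> and
  \<open>Voters\<close> at once.\<close>

lemma time_prepare_search: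
  assumes "s (Elem Values 0) = m" "s (Elem Values (m + 1)) = n"
    and "m \<le> l" "n \<le> l" "s (Elem Counts 1) \<le> l"
  shows "time (prepare ;; search) s \<le> poly (tpoly measure_input + tpoly skip_votes +
    tpoly load_query + pcompose (tpoly search) [:1, 1, 2:]) l"
proof -
  let ?s1 = "run measure_input s"
  let ?s2 = "run skip_votes ?s1"
  have t1: "time measure_input s \<le> poly (tpoly measure_input) l"
    by (rule time_le_tpoly[where Y = "{}"]) (simp_all add: measure_input_def)
  have "?s1 (Var Voters) \<le> l" using assms by (simp add: measure_input_def)
  then have t2: "time skip_votes ?s1 \<le> poly (tpoly skip_votes) l"
    by (intro time_le_tpoly[where Y = "{Voters}"]) (auto simp: skip_votes_def)
  have t3: "time load_query ?s2 \<le> poly (tpoly load_query) l"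
    by (rule time_le_tpoly[where Y = "{}"]) (simp_all add: load_query_def)
  have t4: "time search (run prepare s) \<le> poly (tpoly search) (1 + l + 2 * l * l)"
  proof (rule time_le_tpoly[where Y = "{Cands, Voters, Width}"])
    show "limits search \<subseteq> {Cands, Voters, Width}"
      by (auto simp: search_def challenge_def voter_def places_def gains_def relax_def copy_def)
    show "writes search \<inter> {Cands, Voters, Width} = {}" by (auto simp: search_def)
    have "n * s (Elem Counts 1) \<le> l * l" using assms by (intro mult_le_mono) auto
    then show "run prepare s (Var y) \<le> 1 + l + 2 * l * l" if "y \<in> {Cands, Voters, Width}" for y
      using that run_prepare[OF assms(1,2)] assms(3,4) by auto
  qed
  have pol: "poly [:1, 1, 2:] l = 1 + l + 2 * l * l" by (simp add: algebra_simps)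
  show ?thesis
    unfolding prepare_def run.simps(4) time.simps(4) poly_add poly_pcompose pol
    using t1 t2 t3 t4[unfolded prepare_def run.simps(4)] by linarith
qed

section \<open>The input in memory\<close>

lemma list_tokens_index_less:
  assumes "i < length xss" "j \<le> length (xss ! i)"
  shows "1 + (\<Sum>k<i. Suc (length (xss ! k))) + j < length (list_tokens nat_tokens xss)"
proof -
  have "(\<Sum>k<i. Suc (length (xss ! k))) + j < (\<Sum>k<Suc i. Suc (length (xss ! k)))"
    using assms(2) by simp
  also have "\<dots> \<le> (\<Sum>k<length xss. Suc (length (xss ! k)))"
    using assms(1) by (intro sum_mono2) auto
  finally show ?thesis by (simp add: length_list_tokens)
qed

lemma length_token_le: "k < length ts \<Longrightarrow> length (ts ! k) \<le> length (concat (map token ts))"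
proof (induction ts arbitrary: k)
  case (Cons t ts)
  then show ?case by (cases k) (auto simp: token_def intro: le_SucI trans_le_add2)
qed simp

text \<open>The protocol is read from \<open>Counts\<close>, everything else from
  \<open>Values\<close>. The votes take \<open>n * (m + 1)\<close> tokens after the first
  \<open>m + 2\<close>; then come \<open>d\<close>, the budget, the number of price lists and the
  lists. The last two facts bound the loop limits by the input length.\<close>

lemma tokenized_encode:
  assumes I: "bribery_instance I" "cands I = {1..length \<alpha>}"
  defines "s \<equiv> read_input tokenize (encode \<alpha> I) (\<lambda>_. 0)"
  defines "m \<equiv> length \<alpha>" and "n \<equiv> length (votes I)"
  defines "fp \<equiv> \<lambda>i. finite_prices (prices I ! i)"
  defines "price \<equiv> \<lambda>i. m + 5 + n * (m + 1) + (\<Sum>k<i. Suc (length (fp k)))"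
  shows "s (Elem Values 0) = m"
    "j < m \<Longrightarrow> s (Elem Counts (1 + j)) = \<alpha> ! j"
    "s (Elem Values (m + 1)) = n"
    "i < n \<Longrightarrow> j < m \<Longrightarrow> s (Elem Values (m + 3 + i * (m + 1) + j)) = votes I ! i ! j"
    "s (Elem Values (m + 2 + n * (m + 1))) = despised I"
    "s (Elem Values (m + 3 + n * (m + 1))) = budget I"
    "i < n \<Longrightarrow> s (Elem Values (price i)) = length (fp i)"
    "i < n \<Longrightarrow> t < length (fp i) \<Longrightarrow> s (Elem Values (price i + 1 + t)) = fp i ! t"
    "m + n \<le> length (encode \<alpha> I)"
    "j < m \<Longrightarrow> s (Elem Counts (1 + j)) \<le> length (encode \<alpha> I)"
proof -
  define L0 where "L0 = list_tokens (\<lambda>n. [replicate n True]) \<alpha>"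
  define L1 where "L1 = list_tokens nat_tokens (votes I)"
  define L2 where "L2 = list_tokens nat_tokens (map finite_prices (prices I))"
  define D where "D = [bits (despised I), bits (budget I)]"
  have ts: "tokens \<alpha> I = L0 @ L1 @ D @ L2"
    by (simp add: tokens_def L0_def L1_def L2_def D_def)
  have len_vote: "length (votes I ! i) = m" if "i < n" for i
  proof -
    have "votes I ! i \<in> set (votes I)" using that by (simp add: n_def)
    then have "distinct (votes I ! i)" "set (votes I ! i) = {1..m}"
      using I by (auto simp: bribery_instance_def election_def m_def)
    then show ?thesis using distinct_card[of "votes I ! i"] by simp
  qed
  have len_prices: "length (prices I) = n" using I by (simp add: bribery_instance_def n_def)
  have "concat (map (\<lambda>n. [replicate n True]) xs) = map (\<lambda>n. replicate n True) xs" for xs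
    by (induction xs) auto
  then have L0: "L0 = bits m # map (\<lambda>n. replicate n True) \<alpha>"
    by (simp add: L0_def list_tokens_def m_def)
  then have l0: "length L0 = m + 1" by (simp add: m_def)
  have sum1: "(\<Sum>k<i. Suc (length (votes I ! k))) = i * (m + 1)" if "i \<le> n" for i
    using that by (simp add: len_vote)
  have l1: "length L1 = 1 + n * (m + 1)"
    using sum1[of n] by (simp add: L1_def length_list_tokens n_def)
  have sum2: "(\<Sum>k<i. Suc (length (map finite_prices (prices I) ! k))) = (\<Sum>k<i. Suc (length (fp k)))"
    if "i \<le> n" for i
    using that len_prices by (intro sum.cong) (auto simp: fp_def)
  have "tokenized [] (\<lambda>_. 0)" by (simp add: tokenized_def)
  from read_tokens[OF this, of "tokens \<alpha> I"] have tk: "tokenized (tokens \<alpha> I) s"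
    by (simp add: s_def encode_tokens)
  have vals: "s (Elem Values k) = horner_sum of_bool 2 (tokens \<alpha> I ! k)"
    and counts: "s (Elem Counts k) = length (tokens \<alpha> I ! k)" if "k < length (tokens \<alpha> I)" for k
    using tk that by (simp_all add: tokenized_def)
  have lD: "length D = 2" by (simp add: D_def)
  have at0: "tokens \<alpha> I ! k = L0 ! k" "k < length (tokens \<alpha> I)" if "k < length L0" for k
    using that by (simp_all add: ts nth_append)
  have at1: "tokens \<alpha> I ! (m + 1 + k) = L1 ! k" "m + 1 + k < length (tokens \<alpha> I)"
    if "k < length L1" for k
    using that by (simp_all add: ts nth_append l0)
  have at2: "tokens \<alpha> I ! (m + 2 + n * (m + 1) + k) = D ! k"
      "m + 2 + n * (m + 1) + k < length (tokens \<alpha> I)" if "k < 2" for k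
    using that by (simp_all add: ts nth_append l0 l1 lD)
  have at3: "tokens \<alpha> I ! (m + 4 + n * (m + 1) + k) = L2 ! k"
      "m + 4 + n * (m + 1) + k < length (tokens \<alpha> I)" if "k < length L2" for k
    using that by (simp_all add: ts nth_append l0 l1 D_def)
  show "s (Elem Values 0) = m"
    using vals at0[of 0] l0 by (simp add: L0 horner_sum_bits)
  show "s (Elem Counts (1 + j)) = \<alpha> ! j" if "j < m" for j
    using counts at0[of "1 + j"] l0 that by (simp add: L0 m_def)
  show "s (Elem Values (m + 1)) = n"
    using vals[OF at1(2)[of 0]] at1(1)[of 0] l1
    by (simp add: L1_def list_tokens_def horner_sum_bits n_def)
  show "s (Elem Values (m + 3 + i * (m + 1) + j)) = votes I ! i ! j" if ij: "i < n" "j < m" for i j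
  proof -
    let ?k = "1 + i * (m + 1) + Suc j"
    have "?k < length L1" "L1 ! ?k = bits (votes I ! i ! j)"
      using list_tokens_index_less[of i "votes I" "Suc j"] nth_list_tokens[of i "votes I" "Suc j"]
        ij len_vote sum1[of i] by (simp_all add: L1_def n_def)
    then have "s (Elem Values (m + 1 + ?k)) = votes I ! i ! j"
      using vals[OF at1(2)] at1(1) by (simp add: horner_sum_bits del: add_Suc_right add_Suc)
    moreover have "m + 1 + ?k = m + 3 + i * (m + 1) + j" by simp
    ultimately show ?thesis by metis
  qed
  show "s (Elem Values (m + 2 + n * (m + 1))) = despised I"
    using vals[OF at2(2)[of 0]] at2(1)[of 0] by (simp add: D_def horner_sum_bits)
  have "s (Elem Values (m + 2 + n * (m + 1) + 1)) = horner_sum of_bool 2 (D ! 1)"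
    using vals[OF at2(2)[of 1]] at2(1)[of 1] by (simp only: one_less_numeral_iff semiring_norm)
  moreover have "m + 2 + n * (m + 1) + 1 = m + 3 + n * (m + 1)" by simp
  ultimately show "s (Elem Values (m + 3 + n * (m + 1))) = budget I"
    by (simp only: D_def horner_sum_bits nth_Cons_0 nth_Cons_Suc One_nat_def)
  have price: "s (Elem Values (price i + j)) = (case j of 0 \<Rightarrow> length (fp i) | Suc j \<Rightarrow> fp i ! j)"
    if ij: "i < n" "j \<le> length (fp i)" for i j
  proof -
    let ?k = "1 + (\<Sum>k<i. Suc (length (fp k))) + j"
    have "map finite_prices (prices I) ! i = fp i" using ij len_prices by (simp add: fp_def)
    then have k: "?k < length L2" "L2 ! ?k = bits (case j of 0 \<Rightarrow> length (fp i) | Suc j \<Rightarrow> fp i ! j)"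
      using list_tokens_index_less[of i "map finite_prices (prices I)" j]
        nth_list_tokens[of i "map finite_prices (prices I)" j] ij sum2[of i] len_prices
      by (simp_all only: L2_def length_map less_imp_le)
    have "s (Elem Values (m + 4 + n * (m + 1) + ?k)) = (case j of 0 \<Rightarrow> length (fp i) | Suc j \<Rightarrow> fp i ! j)"
      unfolding vals[OF at3(2)[OF k(1)]] at3(1)[OF k(1)] k(2) horner_sum_bits ..
    moreover have "m + 4 + n * (m + 1) + ?k = price i + j" by (simp add: price_def)
    ultimately show ?thesis by metis
  qed
  show "s (Elem Values (price i)) = length (fp i)" if "i < n" for i
    using price[OF that, of 0] by simp
  show "s (Elem Values (price i + 1 + t)) = fp i ! t" if "i < n" "t < length (fp i)" for i t
    using price[OF that(1), of "Suc t"] that(2) by simp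
  have "m + n \<le> length (tokens \<alpha> I)" using l0 l1 by (simp add: ts)
  then show "m + n \<le> length (encode \<alpha> I)"
    using length_concat_token[of "tokens \<alpha> I"] by (simp add: encode_tokens)
  show "s (Elem Counts (1 + j)) \<le> length (encode \<alpha> I)" if "j < m" for j
    using counts[OF at0(2)[of "1 + j"]] length_token_le[OF at0(2)[of "1 + j"]] that l0
    by (simp add: encode_tokens)
qed

lemma decision:
  assumes I: "bribery_instance I" "cands I = {1..length \<alpha>}"
    and \<alpha>: "scoring_protocol (card (cands I)) \<alpha>"
  defines "s \<equiv> read_input tokenize (encode \<alpha> I) (\<lambda>_. 0)"
  shows "run (prepare ;; search) s (Var Ans) > 0 \<longleftrightarrow>
    destructive_shift_bribery (scoring_rule \<alpha>) I"
proof -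
  define m n d where "m = length \<alpha>" and "n = length (votes I)" and "d = despised I"
  define fp where "fp i = finite_prices (prices I ! i)" for i
  define price where "price i = m + 5 + n * (m + 1) + (\<Sum>k<i. Suc (length (fp k)))" for i
  define V U where "V = (\<lambda>k. s (Elem Values k))" and "U = (\<lambda>k. s (Elem Counts k))"
  define target where "target = n * \<alpha> ! 0"
  note tk = tokenized_encode[OF I, folded s_def m_def n_def fp_def, folded price_def]
  have d: "d \<in> {1..m}" using I by (simp add: bribery_instance_def m_def n_def d_def)
  then have "0 < m" by simp
  have vote: "distinct (votes I ! i)" "set (votes I ! i) = {1..m}" "length (votes I ! i) = m"
    if "i < n" for i
  proof -
    have "votes I ! i \<in> set (votes I)" using that by (simp add: m_def n_def d_def)
    then show *: "distinct (votes I ! i)" "set (votes I ! i) = {1..m}"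
      using I by (auto simp: bribery_instance_def election_def m_def n_def d_def)
    then show "length (votes I ! i) = m" using distinct_card[of "votes I ! i"] by simp
  qed
  have pl: "place (votes I ! i) c < m" if "i < n" "c \<in> {1..m}" for i c
    using place_nth(1)[of c "votes I ! i"] vote[OF that(1)] that(2) by simp
  have pf: "price_function m (pos (votes I ! i) d) (prices I ! i)" if "i < n" for i
    using I that by (simp add: bribery_instance_def m_def n_def d_def)
  have fp_le: "place (votes I ! i) d + length (fp i) \<le> m"
    if "i < n" for i
  proof -
    have "length (fp i) \<le> m - Suc (place (votes I ! i) d) + 1"
      using finite_prices(1)[OF pf[OF that]] by (simp add: fp_def place_def pos_def)
    then show ?thesis using pl[OF that d] by simp
  qed
  interpret search_input V U m n target "budget I" d price "\<lambda>i. place (votes I ! i)"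
  proof
    fix i c j assume i: "i < n" and c: "c \<in> {1..m}" and j: "j < m"
    then show "V (m + 3 + i * (m + 1) + j) = c \<longleftrightarrow> j = place (votes I ! i) c"
      unfolding V_def U_def tk(4)[OF i j]
      using place_eq_iff[of "votes I ! i" j c] vote[OF i] by simp
  next
    show "price (Suc i) = price i + V (price i) + 1" "V (price i) \<le> m" if "i < n" for i
      using tk(7)[OF that] fp_le[OF that] by (simp_all add: V_def U_def price_def)
  qed (use pl d in auto)
  have c1: "s (Elem Counts 1) = \<alpha> ! 0" using tk(2)[OF \<open>0 < m\<close>] by simp
  have index: "m + 2 + n * (m + 1) + 3 = price 0" "m + 2 + n * (m + 1) + 1 = m + 3 + n * (m + 1)"
    by (simp_all add: price_def)
  note rp = run_prepare[OF tk(1,3), unfolded c1 index tk(5,6), folded d_def target_def]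
  have prepare: "env (run prepare s)" "run prepare s (Var Ans) = 0"
    unfolding env_def by (simp_all only: rp V_def U_def simp_thms)
  have U: "U (1 + k) = \<alpha> ! k" if "k < m" for k using tk(2)[OF that] by (simp add: U_def)
  have U1: "U 1 = \<alpha> ! 0" using U[OF \<open>0 < m\<close>] by simp
  have gain: "gain (place (votes I ! i) d) (place (votes I ! i) c) t = shift_gain \<alpha> (votes I ! i) d c t"
    if "i < n" "c \<in> {1..m}" "t < length (fp i)" for i c t
  proof -
    define x where "x = (if place (votes I ! i) d < place (votes I ! i) c \<and>
      place (votes I ! i) c \<le> place (votes I ! i) d + t
      then place (votes I ! i) c - 1 else place (votes I ! i) c)"
    \<comment> \<open>Both indices stay inside the protocol, since shifts of finite price keep
      \<open>d\<close> in the vote; beyond it \<open>U\<close> would return lengths of unrelated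
      tokens.\<close>
    have "x < m" "place (votes I ! i) d + t < m"
      using pl[OF that(1,2)] fp_le[OF that(1)] that(3) by (auto simp: x_def)
    then show ?thesis
      unfolding gain_def shift_gain_def x_def[symmetric] by (simp only: U U1)
  qed
  \<comment> \<open>Each vote gains at most twice the top entry, so no total exceeds
    \<open>2 * target\<close> and the table is wide enough.\<close>
  have gain_le: "shift_gain \<alpha> (votes I ! i) d c t \<le> 2 * \<alpha> ! 0" if "i < n" "c \<in> {1..m}" for i c t
  proof -
    have le: "\<alpha> ! k \<le> \<alpha> ! 0" if "k < m" for k
      using \<alpha> that by (cases k) (auto simp: scoring_protocol_def sorted_wrt_iff_nth_less m_def n_def d_def)
    define x where "x = (if place (votes I ! i) d < place (votes I ! i) c \<and>
      place (votes I ! i) c \<le> place (votes I ! i) d + t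
      then place (votes I ! i) c - 1 else place (votes I ! i) c)"
    have "x < m" using pl[OF that] by (auto simp: x_def)
    from le[OF this] show ?thesis unfolding shift_gain_def x_def[symmetric] by simp
  qed
  have reach: "(\<exists>k < target + target + 1. target \<le> k \<and> reachable c n k (budget I)) \<longleftrightarrow>
      (\<exists>t. (\<forall>i<n. t i < length (fp i)) \<and> (\<Sum>i<n. fp i ! t i) \<le> budget I \<and>
        target \<le> (\<Sum>i<n. shift_gain \<alpha> (votes I ! i) d c (t i)))" if c: "c \<in> {1..m}" for c
  proof -
    have "V (price i) = length (fp i)" if "i < n" for i using tk(7)[OF that] by (simp only: V_def)
    then have V: "(\<forall>i<n. t i < V (price i)) \<longleftrightarrow> (\<forall>i<n. t i < length (fp i))" for t
      by (simp cong: all_cong)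
    have price_nth: "V (price i + 1 + t) = fp i ! t" if "i < n" "t < length (fp i)" for i t
      using tk(8)[OF that] by (simp only: V_def)
    have sums: "(\<Sum>i<n. V (price i + 1 + t i)) = (\<Sum>i<n. fp i ! t i)"
      "(\<Sum>i<n. gain (place (votes I ! i) d) (place (votes I ! i) c) (t i)) =
        (\<Sum>i<n. shift_gain \<alpha> (votes I ! i) d c (t i))" if "\<forall>i<n. t i < length (fp i)" for t
      using that by (auto intro!: sum.cong price_nth gain[OF _ c] simp del: One_nat_def add_Suc_right)
    have bound: "(\<Sum>i<n. shift_gain \<alpha> (votes I ! i) d c (t i)) < target + target + 1" for t
    proof -
      have "(\<Sum>i<n. shift_gain \<alpha> (votes I ! i) d c (t i)) \<le> (\<Sum>i<n. 2 * \<alpha> ! 0)"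
        using gain_le c by (intro sum_mono) auto
      then show ?thesis by (simp add: target_def)
    qed
    \<comment> \<open>The exact total \<open>k\<close> of \<open>reach\<close> is replaced by the
      sum that it equals; the upper limit on this sum holds anyway by \<open>bound\<close>.\<close>
    have "(\<exists>k < target + target + 1. target \<le> k \<and> reachable c n k (budget I)) \<longleftrightarrow>
        (\<exists>t. (\<forall>i<n. t i < length (fp i)) \<and> (\<Sum>i<n. V (price i + 1 + t i)) \<le> budget I \<and>
          target \<le> (\<Sum>i<n. gain (place (votes I ! i) d) (place (votes I ! i) c) (t i)) \<and>
          (\<Sum>i<n. gain (place (votes I ! i) d) (place (votes I ! i) c) (t i)) < target + target + 1)"
      unfolding reachable_def reach_iff V by blast
    then show ?thesis using sums bound by (simp only: simp_thms cong: conj_cong)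
  qed
  have "run (prepare ;; search) s (Var Ans) > 0 \<longleftrightarrow>
      (\<exists>c\<in>{1..m}. c \<noteq> d \<and> (\<exists>k < target + target + 1. target \<le> k \<and> reachable c n k (budget I)))"
    using run_search[OF prepare] by simp
  also have "\<dots> \<longleftrightarrow> destructive_shift_bribery (scoring_rule \<alpha>) I"
    unfolding destructive_shift_bribery_iff[OF I(1) \<alpha>] I(2) using reach
    by (simp add: m_def n_def d_def fp_def target_def)
  finally show ?thesis .
qed

theorem corollary1:
  shows "\<exists>(P :: program) (p :: nat poly). \<forall>(\<alpha> :: nat list) (I :: nat bribery).
    bribery_instance I \<and> cands I = {1..length \<alpha>} \<and> scoring_protocol (card (cands I)) \<alpha> \<longrightarrow>
    answers_within P (encode \<alpha> I) (poly p (length (encode \<alpha> I)))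
      (destructive_shift_bribery (scoring_rule \<alpha>) I)"
proof -
  \<comment> \<open>The time bound is claimed for encodings of instances only: on arbitrary strings
    the tokens taken for the numbers of candidates and voters could be exponentially large.\<close>
  define W where "W = {encode \<alpha> I | \<alpha> I. bribery_instance I \<and> cands I = {1..length \<alpha>}}"
  have lim: "limits tokenize = {}" by (simp add: tokenize_def)
  have time: "time (prepare ;; search) (read_input tokenize w (\<lambda>_. 0)) \<le>
      poly (tpoly measure_input + tpoly skip_votes + tpoly load_query +
        pcompose (tpoly search) [:1, 1, 2:]) (length w)" if w: "w \<in> W" for w
  proof -
    obtain \<alpha> I where I: "w = encode \<alpha> I" "bribery_instance I" "cands I = {1..length \<alpha>}"
      using w unfolding W_def by blast
    note tk = tokenized_encode[OF I(2,3), folded I(1)]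
    have "despised I \<in> cands I" using I(2) by (simp add: bribery_instance_def)
    then have "1 \<le> despised I" "despised I \<le> length \<alpha>" using I(3) by simp_all
    \<comment> \<open>Since \<open>d\<close> is a candidate, the protocol is nonempty, and token 1
      is its first entry rather than the number of votes.\<close>
    then have "0 < length \<alpha>" by linarith
    then show ?thesis
      using tk(9) tk(10)[of 0] by (intro time_prepare_search[OF tk(1,3)]) simp_all
  qed
  obtain p where p: "\<forall>w\<in>W. answers_within (program tokenize (prepare ;; search)) w (poly p (length w))
      (run (prepare ;; search) (read_input tokenize w (\<lambda>_. 0)) (Var Ans) > 0)"
    using program_answers_within[OF lim time] by blast
  show ?thesis
  proof (intro exI allI impI)
    fix \<alpha> and I :: "nat bribery"
    assume *: "bribery_instance I \<and> cands I = {1..length \<alpha>} \<and> scoring_protocol (card (cands I)) \<alpha>"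
    then have "encode \<alpha> I \<in> W" by (auto simp: W_def)
    with p have "answers_within (program tokenize (prepare ;; search)) (encode \<alpha> I)
        (poly p (length (encode \<alpha> I)))
        (run (prepare ;; search) (read_input tokenize (encode \<alpha> I) (\<lambda>_. 0)) (Var Ans) > 0)"
      by blast
    moreover have "run (prepare ;; search) (read_input tokenize (encode \<alpha> I) (\<lambda>_. 0)) (Var Ans) > 0 \<longleftrightarrow>
        destructive_shift_bribery (scoring_rule \<alpha>) I"
      using decision * by blast
    ultimately show "answers_within (program tokenize (prepare ;; search)) (encode \<alpha> I)
        (poly p (length (encode \<alpha> I))) (destructive_shift_bribery (scoring_rule \<alpha>) I)"
      by (simp only:)
  qed
qed

end
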